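(* For all $q\in\mathbf{C}$ with $|q|<1$, $$\frac{\psi_{2}}{\psi_{0}}=\mathcal{P},\qquad \frac{\psi_{4}}{\psi_{0}}=3\mathcal{P}^{2}-2\mathcal{Q},\qquad \frac{\psi_{6}}{\psi_{0}}=15\mathcal{P}^{3}-30\mathcal{P}\mathcal{Q}+16\mathcal{R}.$$ Moreover, for each integer $n\ge 0$, there exist integers $K_{ijkl}$ (independent of $q$) such that $$\frac{\psi_{2n}}{\psi_{0}}=\sum_{\substack{i,j,k,l\ge 0\\ 2i+2j+4k+6l=2n}}K_{ijkl}\,\mathcal{P}^{i}\mathcal{E}^{j}\mathcal{Q}^{k}\mathcal{R}^{l}.$$
   Context: Throughout $q\in\mathbf{C}$ with $|q|<1$. For $n\ge 0$ let $\psi_{n}(q)=\sum_{k=0}^{\infty}(2k+1)^{n}q^{k(k+1)/2}$. For $n\ge1$ let $\widetilde{\sigma}_{s}(n)=\sum_{d\mid n}(-1)^{d-1}d^{s}$ and $\widehat{\sigma}_{s}(n)=\sum_{d\mid n}(-1)^{n/d-1}d^{s}$, with $\widetilde{\sigma}=\widetilde{\sigma}_{1}$, $\widehat{\sigma}=\widehat{\sigma}_{1}$, and set $\widetilde{\sigma}(0)=\tfrac18$, $\widehat{\sigma}(0)=\tfrac1{24}$, $\widetilde{\sigma}_{3}(0)=-\tfrac1{16}$, $\widetilde{\sigma}_{5}(0)=\tfrac18$. Define $$\mathcal{P}(q)=\sum_{n=0}^{\infty}8\widetilde{\sigma}(n)q^{n},\quad \mathcal{E}(q)=\sum_{n=0}^{\infty}24\widehat{\sigma}(n)q^{n},\quad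 \mathcal{Q}(q)=\sum_{n=0}^{\infty}(-16\widetilde{\sigma}_{3}(n))q^{n},\quad \mathcal{R}(q)=\sum_{n=0}^{\infty}8\widetilde{\sigma}_{5}(n)q^{n}.$$ In the claim, $\psi_n,\mathcal{P},\mathcal{E},\mathcal{Q},\mathcal{R}$ stand for their values at $q$. *)

theory Defs
  imports Complex_Main
begin

definition psi :: "nat \<Rightarrow> complex \<Rightarrow> complex" where
  "psi n q = (\<Sum>k. of_nat (2 * k + 1) ^ n * q ^ (k * (k + 1) div 2))"

text \<open>
  The divisor sums are only specified for positive arguments; at zero they are given
  conventional values for the exponents 1, 3, 5 (respectively 1) and are left
  undefined for all other exponents.
\<close>

definition sigma_tilde :: "nat \<Rightarrow> nat \<Rightarrow> complex" where
  "sigma_tilde s n =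
     (if n = 0
      then (if s = 1 then 1 / 8 else if s = 3 then - 1 / 16 else if s = 5 then 1 / 8 else undefined)
      else (\<Sum>d | d dvd n. (-1) ^ (d - 1) * of_nat d ^ s))"

definition sigma_hat :: "nat \<Rightarrow> nat \<Rightarrow> complex" where
  "sigma_hat s n =
     (if n = 0
      then (if s = 1 then 1 / 24 else undefined)
      else (\<Sum>d | d dvd n. (-1) ^ (n div d - 1) * of_nat d ^ s))"

definition calP :: "complex \<Rightarrow> complex" where
  "calP q = (\<Sum>n. 8 * sigma_tilde 1 n * q ^ n)"

definition calE :: "complex \<Rightarrow> complex" where
  "calE q = (\<Sum>n. 24 * sigma_hat 1 n * q ^ n)"

definition calQ :: "complex \<Rightarrow> complex" where
  "calQ q = (\<Sum>n. (- 16 * sigma_tilde 3 n) * q ^ n)"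

definition calR :: "complex \<Rightarrow> complex" where
  "calR q = (\<Sum>n. 8 * sigma_tilde 5 n * q ^ n)"

end

theory Submission
  imports Defs "HOL-Analysis.FPS_Convergence" "HOL-Computational_Algebra.Formal_Laurent_Series"
begin

text \<open>
  Let $\theta = q\,d/dq$. Since $(2k+1)^2 = 8\,k(k+1)/2 + 1$, one has
  $\psi_{n+2} = \psi_n + 8\theta\psi_n$, and Gauss' product for $\psi_0$ gives
  $8\theta\psi_0 = (P-1)\psi_0$. Hence the quotients $u_n = \psi_{2n}/\psi_0$ satisfy
  $u_{n+1} = P u_n + 8\theta u_n$, and everything follows from
  $4\theta P = P^2 - Q$, $2\theta E = PE - Q$, $\theta Q = PQ - R$ and $R = EQ$.

  The equations for $\theta P$ and $\theta Q$ come from the relation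
  $u_a u_b = u_{a+b}(1 + u_a + u_b)$ for $u_k = q^k/(1-q^k)$, which turns a product of two Lambert
  series into a single sum by telescoping. The same computation without signs gives
  Ramanujan's equations for the Eisenstein series of weight 2 and 4, at $q$ and at $q^2$;
  comparing the two versions yields the equation for $\theta E$ and $R = EQ$ by linear elimination.
  All this takes place in formal power series. At a point of the disc, $\psi_0$ does not vanish
  because it is the exponential of a convergent power series.
\<close>

lemma sum_square_split:
  fixes f :: "nat \<Rightarrow> nat \<Rightarrow> 'a::comm_monoid_add"
  shows "(\<Sum>a=1..n. \<Sum>b=1..n. f a b) =
    (\<Sum>a=1..n. f a a) + (\<Sum>a=1..n. \<Sum>b=1..<a. f a b) + (\<Sum>a=1..n. \<Sum>b=1..<a. f b a)"
proof -
  have split: "(\<Sum>b=1..n. f a b) = f a a + (\<Sum>b=1..<a. f a b) + (\<Sum>b | b \<in> {1..n} \<and> a < b. f a b)"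
    if "a \<in> {1..n}" for a
  proof -
    have "{1..n} = {a} \<union> ({1..<a} \<union> {b. b \<in> {1..n} \<and> a < b})"
      using that by auto
    then have "(\<Sum>b=1..n. f a b) = sum (f a) ({a} \<union> ({1..<a} \<union> {b. b \<in> {1..n} \<and> a < b}))"
      by (rule arg_cong)
    also have "\<dots> = f a a + sum (f a) ({1..<a} \<union> {b. b \<in> {1..n} \<and> a < b})"
      by (subst sum.union_disjoint) auto
    also have "sum (f a) ({1..<a} \<union> {b. b \<in> {1..n} \<and> a < b})
        = sum (f a) {1..<a} + sum (f a) {b. b \<in> {1..n} \<and> a < b}"
      by (rule sum.union_disjoint) auto
    finally show ?thesis by (simp add: add.assoc)
  qed
  have "(\<Sum>a=1..n. \<Sum>b | b \<in> {1..n} \<and> a < b. f a b) = (\<Sum>b=1..n. \<Sum>a | a \<in> {1..n} \<and> a < b. f a b)"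
    by (rule sum.swap_restrict) auto
  also have "\<dots> = (\<Sum>b=1..n. \<Sum>a=1..<b. f a b)"
    by (intro sum.cong) auto
  finally show ?thesis
    using split by (simp add: sum.distrib)
qed

lemma sum_square_shift:
  fixes f :: "nat \<Rightarrow> nat \<Rightarrow> 'a::comm_monoid_add"
  assumes "\<And>a b. a > n \<Longrightarrow> f a b = 0"
  shows "(\<Sum>a=1..n. \<Sum>b=1..n. f (a + b) b) = (\<Sum>a=1..n. \<Sum>b=1..<a. f a b)"
proof -
  have "(\<Sum>a=1..n. f (a + b) b) = (\<Sum>a | a \<in> {1..n} \<and> b < a. f a b)" if "b \<in> {1..n}" for b
  proof -
    have "(\<Sum>a=1..n. f (a + b) b) = (\<Sum>a=1+b..n+b. f a b)"
      by (rule sum.shift_bounds_cl_nat_ivl [symmetric])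
    also have "\<dots> = (\<Sum>a | a \<in> {1..n} \<and> b < a. f a b)"
    proof (rule sum.mono_neutral_right)
      show "\<forall>a \<in> {1+b..n+b} - {a. a \<in> {1..n} \<and> b < a}. f a b = 0"
        by (auto simp: not_le intro!: assms)
    qed auto
    finally show ?thesis .
  qed
  then have "(\<Sum>a=1..n. \<Sum>b=1..n. f (a + b) b) = (\<Sum>b=1..n. \<Sum>a | a \<in> {1..n} \<and> b < a. f a b)"
    by (subst sum.swap) simp
  also have "\<dots> = (\<Sum>a=1..n. \<Sum>b | b \<in> {1..n} \<and> b < a. f a b)"
    by (rule sum.swap_restrict [symmetric]) auto
  also have "\<dots> = (\<Sum>a=1..n. \<Sum>b=1..<a. f a b)"
    by (intro sum.cong) auto
  finally show ?thesis .
qed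

text \<open>With \<open>\<nu> k\<close> and \<open>\<beta> a b\<close> the coefficients of $u_k = q^k/(1-q^k)$ and $u_a u_b$, this is
  Ramanujan's identity for the square of a cotangent-type Lambert series, with an arbitrary
  function \<open>C\<close> in place of the cosine.\<close>

lemma convolution_identity:
  fixes W \<beta> :: "nat \<Rightarrow> nat \<Rightarrow> 'a::comm_ring_1" and C \<nu> :: "nat \<Rightarrow> 'a"
  assumes W_sym: "\<And>a b. W a b = W b a"
    and W_diag: "\<And>a. W a a = - C (2 * a)"
    and W_off: "\<And>a k. W (k + a) a = C k - C (2 * a + k)"
    and \<beta>_sym: "\<And>a b. \<beta> a b = \<beta> b a"
    and \<beta>_0: "\<And>a b. a + b > n \<Longrightarrow> \<beta> a b = 0"
    and \<nu>_0: "\<And>a. a > n \<Longrightarrow> \<nu> a = 0"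
    and rel: "\<And>a b. a \<ge> 1 \<Longrightarrow> b \<ge> 1 \<Longrightarrow> \<beta> a b = \<nu> (a + b) + \<beta> (a + b) a + \<beta> (a + b) b"
  shows "(\<Sum>a=1..n. \<Sum>b=1..n. W a b * \<beta> a b) =
    (\<Sum>k=1..n. C k * (2 * \<beta> k k - of_nat (k - 1) * \<nu> k)) - 2 * (\<Sum>k=1..n. \<nu> k * (\<Sum>j=1..<k. C j))"
proof -
  define sq where "sq f = (\<Sum>a=1..n. \<Sum>b=1..n. f a b)" for f :: "nat \<Rightarrow> nat \<Rightarrow> 'a"
  define tri where "tri f = (\<Sum>a=1..n. \<Sum>b=1..<a. f a b)" for f :: "nat \<Rightarrow> nat \<Rightarrow> 'a"
  have split: "sq f = (\<Sum>a=1..n. f a a) + tri f + tri (\<lambda>a b. f b a)" for f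
    unfolding sq_def tri_def by (rule sum_square_split)
  have shift: "sq (\<lambda>a b. f (a + b) b) = tri f" if "\<And>a b. a > n \<Longrightarrow> f a b = 0" for f
    unfolding sq_def tri_def using that by (rule sum_square_shift)
  have sq_add: "sq (\<lambda>a b. f a b + g a b) = sq f + sq g"
    and sq_diff: "sq (\<lambda>a b. f a b - g a b) = sq f - sq g" for f g
    by (simp_all add: sq_def sum.distrib sum_subtractf)
  have sq_cong: "sq f = sq g" if "\<And>a b. a \<ge> 1 \<Longrightarrow> b \<ge> 1 \<Longrightarrow> f a b = g a b" for f g
    unfolding sq_def using that by (intro sum.cong) auto
  have sq_swap: "sq (\<lambda>a b. f b a) = sq f" for f
    unfolding sq_def by (rule sum.swap)
  let ?D = "\<Sum>k=1..n. C k * \<beta> k k"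
  let ?T = "tri (\<lambda>a b. C a * \<beta> a b)"
  let ?T1 = "sq (\<lambda>k b. C k * \<beta> (k + b) b)"
  let ?T2 = "sq (\<lambda>k b. C (2 * b + k) * \<beta> (k + b) b)"
  have sym: "sq f = (\<Sum>a=1..n. f a a) + 2 * sq (\<lambda>k b. f (k + b) b)"
    if "\<And>a b. f a b = f b a" "\<And>a b. a > n \<Longrightarrow> f a b = 0" for f
  proof -
    have "tri (\<lambda>a b. f b a) = tri f"
      by (intro arg_cong[where f = tri] ext that(1))
    moreover have "sq (\<lambda>k b. f (k + b) b) = tri f"
      by (rule shift) (rule that(2))
    ultimately show ?thesis
      unfolding split[of f] by (simp only: mult_2 add.assoc)
  qed
  have "sq (\<lambda>a b. W a b * \<beta> a b) =
      (\<Sum>a=1..n. W a a * \<beta> a a) + 2 * sq (\<lambda>k b. W (k + b) b * \<beta> (k + b) b)"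
    by (rule sym) (simp_all add: \<beta>_0, metis W_sym \<beta>_sym)
  also have "sq (\<lambda>k b. W (k + b) b * \<beta> (k + b) b) = ?T1 - ?T2"
    by (simp only: sq_diff [symmetric] W_off left_diff_distrib)
  finally have lhs: "sq (\<lambda>a b. W a b * \<beta> a b) = - (\<Sum>a=1..n. C (2 * a) * \<beta> a a) + 2 * (?T1 - ?T2)"
    by (simp only: W_diag mult_minus_left sum_negf)
  have "sq (\<lambda>a b. C (a + b) * \<beta> a b) =
      (\<Sum>a=1..n. C (a + a) * \<beta> a a) + 2 * sq (\<lambda>k b. C (k + b + b) * \<beta> (k + b) b)"
    by (rule sym) (simp_all add: \<beta>_0, metis add.commute \<beta>_sym)
  then have X1: "sq (\<lambda>a b. C (a + b) * \<beta> a b) = (\<Sum>a=1..n. C (2 * a) * \<beta> a a) + 2 * ?T2"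
    by (simp only: mult_2 add_ac)
  have X2: "sq (\<lambda>a b. C (a + b) * \<beta> a b) = tri (\<lambda>a b. C a * \<nu> a) + 2 * ?T"
  proof -
    have "sq (\<lambda>a b. C (a + b) * \<beta> a b) = sq (\<lambda>a b. C (a + b) * \<nu> (a + b))
        + sq (\<lambda>a b. C (a + b) * \<beta> (a + b) b) + sq (\<lambda>a b. C (b + a) * \<beta> (b + a) a)"
      unfolding sq_add [symmetric]
    proof (rule sq_cong)
      fix a b :: nat assume "a \<ge> 1" "b \<ge> 1"
      from rel[OF this] show "C (a + b) * \<beta> a b =
          C (a + b) * \<nu> (a + b) + C (a + b) * \<beta> (a + b) b + C (b + a) * \<beta> (b + a) a"
        by (simp add: algebra_simps)
    qed
    moreover have "sq (\<lambda>a b. C (b + a) * \<beta> (b + a) a) = sq (\<lambda>a b. C (a + b) * \<beta> (a + b) b)"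
      by (rule sq_swap)
    moreover have "sq (\<lambda>a b. C (a + b) * \<beta> (a + b) b) = ?T"
      by (rule shift) (simp add: \<beta>_0)
    moreover have "sq (\<lambda>a b. C (a + b) * \<nu> (a + b)) = tri (\<lambda>a b. C a * \<nu> a)"
      by (rule shift[of "\<lambda>a b. C a * \<nu> a"]) (simp add: \<nu>_0)
    ultimately show ?thesis
      by (simp only: mult_2 add.assoc)
  qed
  have X3: "tri (\<lambda>a b. C a * \<nu> a) = (\<Sum>k=1..n. C k * (of_nat (k - 1) * \<nu> k))"
    by (simp add: tri_def algebra_simps)
  have X4: "?T1 = ?D + ?T - tri (\<lambda>a b. C b * \<nu> a)"
  proof -
    have "?T1 = sq (\<lambda>k b. C k * \<beta> k b) - sq (\<lambda>k b. C k * \<nu> (b + k)) - sq (\<lambda>k b. C k * \<beta> (b + k) k)"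
      unfolding sq_diff [symmetric]
    proof (rule sq_cong)
      fix k b :: nat assume "k \<ge> 1" "b \<ge> 1"
      from rel[OF this] show "C k * \<beta> (k + b) b =
          C k * \<beta> k b - C k * \<nu> (b + k) - C k * \<beta> (b + k) k"
        by (simp add: algebra_simps)
    qed
    also have "sq (\<lambda>k b. C k * \<nu> (b + k)) = tri (\<lambda>a b. C b * \<nu> a)"
      by (subst sq_swap) (rule shift, simp add: \<nu>_0)
    also have "sq (\<lambda>k b. C k * \<beta> (b + k) k) = tri (\<lambda>a b. C b * \<beta> a b)"
      by (subst sq_swap) (rule shift, simp add: \<beta>_0)
    also have "sq (\<lambda>k b. C k * \<beta> k b) = ?D + ?T + tri (\<lambda>a b. C b * \<beta> a b)"
      by (subst split) (simp only: \<beta>_sym)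
    finally show ?thesis by simp
  qed
  have X5: "tri (\<lambda>a b. C b * \<nu> a) = (\<Sum>k=1..n. \<nu> k * (\<Sum>j=1..<k. C j))"
    by (simp add: tri_def sum_distrib_left mult.commute)
  have "sq (\<lambda>a b. W a b * \<beta> a b) = 2 * ?T1 - sq (\<lambda>a b. C (a + b) * \<beta> a b)"
    unfolding lhs X1 by (simp add: right_diff_distrib)
  also have "\<dots> = 2 * ?D - (\<Sum>k=1..n. C k * (of_nat (k - 1) * \<nu> k))
      - 2 * (\<Sum>k=1..n. \<nu> k * (\<Sum>j=1..<k. C j))"
    unfolding X2 X3 X4 X5 by (simp only: distrib_left right_diff_distrib) simp
  finally have "sq (\<lambda>a b. W a b * \<beta> a b) = 2 * ?D - (\<Sum>k=1..n. C k * (of_nat (k - 1) * \<nu> k))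
      - 2 * (\<Sum>k=1..n. \<nu> k * (\<Sum>j=1..<k. C j))" .
  then show ?thesis
    unfolding sq_def by (simp add: sum_subtractf sum_distrib_left right_diff_distrib mult_ac)
qed

subsection \<open>Lambert series\<close>

definition theta :: "complex fps \<Rightarrow> complex fps" where
  "theta f = fps_X * fps_deriv f"

lemma theta_nth: "fps_nth (theta f) n = of_nat n * fps_nth f n"
  by (cases n) (simp_all add: theta_def)

lemma theta_simps:
  "theta (f + g) = theta f + theta g"
  "theta (f - g) = theta f - theta g"
  "theta (f * g) = theta f * g + f * theta g"
  "theta (numeral w) = 0"
  "theta 1 = 0"
  "theta (- f) = - theta f"
  by (simp_all add: theta_def algebra_simps numeral_fps_const)

lemma theta_X_power: "theta (fps_X ^ k) = of_nat k * fps_X ^ k"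
  by (rule fps_ext) (simp add: theta_nth flip: fps_of_nat)

definition geom :: "nat \<Rightarrow> complex fps" where
  "geom k = Abs_fps (\<lambda>n. if 0 < n \<and> k dvd n then 1 else 0)"

lemma geom_nth: "fps_nth (geom k) n = (if 0 < n \<and> k dvd n then 1 else 0)"
  by (simp add: geom_def)

lemma geom_eq:
  assumes "k > 0"
  shows "geom k * (1 - fps_X ^ k) = fps_X ^ k"
proof (rule fps_ext)
  fix n
  show "fps_nth (geom k * (1 - fps_X ^ k)) n = fps_nth (fps_X ^ k) n"
    using assms
    by (auto simp: right_diff_distrib fps_X_power_mult_right_nth geom_nth dvd_minus_self
        dest: dvd_imp_le)
qed

lemma one_minus_X_power_neq_0:
  assumes "k > 0"
  shows "1 - fps_X ^ k \<noteq> (0 :: complex fps)"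
proof
  assume "1 - fps_X ^ k = (0 :: complex fps)"
  then have "fps_nth (1 - fps_X ^ k :: complex fps) 0 = 0"
    by (simp only: fps_zero_nth)
  with assms show False by simp
qed

lemma geom_mult:
  assumes "a > 0" "b > 0"
  shows "geom a * geom b = geom (a + b) * (1 + geom a + geom b)"
proof -
  define x y :: "complex fps" where "x = fps_X ^ a" and "y = fps_X ^ b"
  have eqs: "geom a * (1 - x) = x" "geom b * (1 - y) = y" "geom (a + b) * (1 - x * y) = x * y"
    using geom_eq[of a] geom_eq[of b] geom_eq[of "a + b"] assms
    by (simp_all add: x_def y_def power_add)
  have "(geom a * geom b - geom (a + b) * (1 + geom a + geom b)) * ((1 - x) * (1 - y) * (1 - x * y)) = 0"
  proof -
    have "(geom a * geom b - geom (a + b) * (1 + geom a + geom b)) * ((1 - x) * (1 - y) * (1 - x * y))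
      = (geom a * (1 - x)) * (geom b * (1 - y)) * (1 - x * y) - (geom (a + b) * (1 - x * y)) *
        ((1 - x) * (1 - y) + (geom a * (1 - x)) * (1 - y) + (geom b * (1 - y)) * (1 - x))"
      by (simp add: algebra_simps)
    then show ?thesis
      unfolding eqs by (simp add: algebra_simps)
  qed
  moreover have "(1 - x) * (1 - y) * (1 - x * y) \<noteq> 0"
    using one_minus_X_power_neq_0[of a] one_minus_X_power_neq_0[of b]
      one_minus_X_power_neq_0[of "a + b"] assms
    unfolding x_def y_def power_add by (simp only: mult_eq_0_iff) simp
  ultimately show ?thesis by (metis mult_eq_0_iff right_minus_eq)
qed

lemma theta_geom:
  assumes "k > 0"
  shows "theta (geom k) = of_nat k * (geom k + geom k ^ 2)"
proof -
  have "theta (geom k * (1 - fps_X ^ k)) = of_nat k * fps_X ^ k"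
    using assms by (simp add: geom_eq theta_X_power)
  then have "theta (geom k) * (1 - fps_X ^ k) - geom k * (of_nat k * fps_X ^ k) = of_nat k * fps_X ^ k"
    by (simp only: theta_simps theta_X_power) simp
  moreover have "(theta (geom k) - of_nat k * (geom k + geom k ^ 2)) * (1 - fps_X ^ k) =
      theta (geom k) * (1 - fps_X ^ k) - of_nat k * (geom k * (1 - fps_X ^ k))
        - of_nat k * (geom k * (geom k * (1 - fps_X ^ k)))"
    by (simp add: algebra_simps power2_eq_square)
  ultimately have "(theta (geom k) - of_nat k * (geom k + geom k ^ 2)) * (1 - fps_X ^ k) = 0"
    unfolding geom_eq[OF assms] by (simp add: algebra_simps)
  then show ?thesis
    using one_minus_X_power_neq_0[OF assms] by (metis mult_eq_0_iff right_minus_eq)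
qed

definition lambert :: "(nat \<Rightarrow> complex) \<Rightarrow> complex fps" where
  "lambert c = Abs_fps (\<lambda>n. if n = 0 then 0 else \<Sum>d | d dvd n. c d)"

lemma lambert_nth: "fps_nth (lambert c) n = (if n = 0 then 0 else \<Sum>d | d dvd n. c d)"
  by (simp add: lambert_def)

lemma lambert_nth_geom:
  assumes "n \<le> N"
  shows "fps_nth (lambert c) n = (\<Sum>k=1..N. c k * fps_nth (geom k) n)"
proof (cases "n = 0")
  case False
  then have "(\<Sum>d | d dvd n. c d) = (\<Sum>k\<in>{1..N} \<inter> {k. k dvd n}. c k)"
    using assms dvd_imp_le[of _ n] by (intro sum.cong) (force simp: Suc_le_eq intro: Nat.gr0I)+
  also have "\<dots> = (\<Sum>k=1..N. c k * fps_nth (geom k) n)"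
    using False by (auto simp: sum.inter_restrict geom_nth intro!: sum.cong)
  finally show ?thesis using False by (simp add: lambert_nth)
qed (simp add: lambert_nth geom_nth)

lemma lambert_mult_nth:
  "fps_nth (lambert c * lambert d) n = (\<Sum>a=1..n. \<Sum>b=1..n. c a * d b * fps_nth (geom a * geom b) n)"
proof -
  have "fps_nth (lambert c * lambert d) n = (\<Sum>i=0..n. (\<Sum>a=1..n. c a * fps_nth (geom a) i)
      * (\<Sum>b=1..n. d b * fps_nth (geom b) (n - i)))"
    unfolding fps_mult_nth by (intro sum.cong refl) (simp add: lambert_nth_geom[of _ n])
  also have "\<dots> = (\<Sum>i=0..n. \<Sum>a=1..n. \<Sum>b=1..n. c a * fps_nth (geom a) i
      * (d b * fps_nth (geom b) (n - i)))"
    by (simp add: sum_product)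
  also have "\<dots> = (\<Sum>a=1..n. \<Sum>i=0..n. \<Sum>b=1..n. c a * fps_nth (geom a) i
      * (d b * fps_nth (geom b) (n - i)))"
    by (rule sum.swap)
  also have "\<dots> = (\<Sum>a=1..n. \<Sum>b=1..n. \<Sum>i=0..n. c a * fps_nth (geom a) i
      * (d b * fps_nth (geom b) (n - i)))"
    by (intro sum.cong refl sum.swap)
  also have "\<dots> = (\<Sum>a=1..n. \<Sum>b=1..n. c a * d b * fps_nth (geom a * geom b) n)"
    by (simp add: fps_mult_nth sum_distrib_left mult_ac)
  finally show ?thesis .
qed

lemma theta_lambert_nth:
  "fps_nth (theta (lambert c)) n =
    (\<Sum>k=1..n. of_nat k * c k * (fps_nth (geom k) n + fps_nth (geom k * geom k) n))"
proof -
  have "of_nat n * fps_nth (geom k) n = of_nat k * (fps_nth (geom k) n + fps_nth (geom k * geom k) n)"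
    if "k \<ge> 1" for k
    using that arg_cong[OF theta_geom[of k], of "\<lambda>f. fps_nth f n"]
    by (simp add: theta_nth power2_eq_square flip: fps_of_nat)
  then have "of_nat n * (c k * fps_nth (geom k) n)
      = of_nat k * c k * (fps_nth (geom k) n + fps_nth (geom k * geom k) n)"
    if "k \<in> {1..n}" for k
    using that by (simp add: mult.left_commute mult.assoc)
  then show ?thesis
    unfolding theta_nth lambert_nth_geom[OF order.refl] sum_distrib_left by (intro sum.cong refl)
qed

lemma geom_convolution:
  fixes C :: "nat \<Rightarrow> complex"
  assumes W_sym: "\<And>a b. W a b = W b a"
    and W_diag: "\<And>a. W a a = - (of_nat (2 * a) * C (2 * a))"
    and W_off: "\<And>a k. W (k + a) a = of_nat k * C k - of_nat (2 * a + k) * C (2 * a + k)"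
  shows "(\<Sum>a=1..n. \<Sum>b=1..n. W a b * fps_nth (geom a * geom b) n) =
    fps_nth (2 * theta (lambert C) -
      lambert (\<lambda>k. of_nat (k + 1) * (of_nat k * C k) + 2 * (\<Sum>j=1..<k. of_nat j * C j))) n"
proof -
  let ?D = "\<lambda>k. of_nat k * C k"
  define S where "S k = (\<Sum>j=1..<k. ?D j)" for k
  have "(\<Sum>a=1..n. \<Sum>b=1..n. W a b * fps_nth (geom a * geom b) n) =
    (\<Sum>k=1..n. ?D k * (2 * fps_nth (geom k * geom k) n - of_nat (k - 1) * fps_nth (geom k) n))
      - 2 * (\<Sum>k=1..n. fps_nth (geom k) n * S k)"
    unfolding S_def
  proof (rule convolution_identity)
    fix a b :: nat
    assume "a \<ge> 1" "b \<ge> 1"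
    then show "fps_nth (geom a * geom b) n = fps_nth (geom (a + b)) n
        + fps_nth (geom (a + b) * geom a) n + fps_nth (geom (a + b) * geom b) n"
      by (subst geom_mult) (simp_all add: distrib_left)
  next
    fix a b :: nat
    assume "n < a + b"
    then have "fps_nth (geom a) i * fps_nth (geom b) (n - i) = 0" if "i \<le> n" for i
      using that by (auto simp: geom_nth dest!: dvd_imp_le)
    then show "fps_nth (geom a * geom b) n = 0"
      unfolding fps_mult_nth by (intro sum.neutral) simp
  next
    fix a assume "n < a" then show "fps_nth (geom a) n = 0"
      by (auto simp: geom_nth dest: dvd_imp_le)
  qed (use assms in \<open>auto simp: mult.commute\<close>)
  also have "\<dots> = 2 * fps_nth (theta (lambert C)) n - (\<Sum>k=1..n.
      (of_nat (k + 1) * ?D k + 2 * S k) * fps_nth (geom k) n)"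
    unfolding theta_lambert_nth sum_distrib_left sum_subtractf [symmetric]
  proof (intro sum.cong refl)
    fix k assume "k \<in> {1..n}"
    then have eq: "of_nat (k - 1) = (of_nat k - 1 :: complex)"
      by (cases k) simp_all
    show "?D k * (2 * fps_nth (geom k * geom k) n - of_nat (k - 1) * fps_nth (geom k) n)
        - 2 * (fps_nth (geom k) n * S k)
      = 2 * (?D k * (fps_nth (geom k) n + fps_nth (geom k * geom k) n))
        - (of_nat (k + 1) * ?D k + 2 * S k) * fps_nth (geom k) n"
      unfolding eq by (simp add: algebra_simps)
  qed
  finally show ?thesis
    unfolding S_def by (simp add: lambert_nth_geom[of n n] numeral_fps_const)
qed

definition lambert_pow :: "complex \<Rightarrow> nat \<Rightarrow> complex fps" where
  "lambert_pow e s = lambert (\<lambda>k. e ^ k * of_nat k ^ s)"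

lemma lambert_cong: "(\<And>k. k > 0 \<Longrightarrow> c k = d k) \<Longrightarrow> lambert c = lambert d"
  by (auto simp: fps_eq_iff lambert_nth intro!: sum.cong Nat.gr0I)

lemma lambert_add: "lambert (\<lambda>k. c k + d k) = lambert c + lambert d"
  by (auto simp: fps_eq_iff lambert_nth sum.distrib)

lemma lambert_diff: "lambert (\<lambda>k. c k - d k) = lambert c - lambert d"
  by (auto simp: fps_eq_iff lambert_nth sum_subtractf)

lemma lambert_numeral_mult: "lambert (\<lambda>k. numeral w * c k) = numeral w * lambert c"
  by (auto simp: fps_eq_iff lambert_nth sum_distrib_left numeral_fps_const)

lemma power_parity:
  fixes e :: complex
  assumes "e ^ 2 = 1"
  shows "e ^ a * e ^ a = 1" "e ^ (2 * a + k) = e ^ k" "e ^ (k + a) * e ^ a = e ^ k"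
proof -
  show sq: "e ^ a * e ^ a = 1" for a
    using assms by (simp add: power2_eq_square flip: power_mult_distrib)
  show "e ^ (2 * a + k) = e ^ k" "e ^ (k + a) * e ^ a = e ^ k"
    by (simp_all add: sq power_add mult_2 mult.assoc)
qed

lemma lambert_pow_square:
  assumes "e ^ 2 = 1"
  shows "- 4 * (lambert_pow e 1 * lambert_pow e 1) = 2 * theta (lambert_pow e 1) -
    lambert (\<lambda>k. of_nat (k + 1) * (of_nat k * (e ^ k * of_nat k ^ 1))
    + 2 * (\<Sum>j=1..<k. of_nat j * (e ^ j * of_nat j ^ 1)))"
proof (rule fps_ext)
  fix n
  let ?W = "\<lambda>a b. - 4 * (e ^ a * of_nat a ^ 1) * (e ^ b * of_nat b ^ 1)"
  have "fps_nth (- 4 * (lambert_pow e 1 * lambert_pow e 1)) n =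
      - 4 * fps_nth (lambert_pow e 1 * lambert_pow e 1) n"
    by (simp add: numeral_fps_const)
  also have "\<dots> = (\<Sum>a=1..n. \<Sum>b=1..n. ?W a b * fps_nth (geom a * geom b) n)"
    unfolding lambert_pow_def lambert_mult_nth sum_distrib_left by (intro sum.cong refl) (simp only: mult_ac)
  also have "\<dots> = fps_nth (2 * theta (lambert_pow e 1) -
    lambert (\<lambda>k. of_nat (k + 1) * (of_nat k * (e ^ k * of_nat k ^ 1))
    + 2 * (\<Sum>j=1..<k. of_nat j * (e ^ j * of_nat j ^ 1)))) n"
    unfolding lambert_pow_def
  proof (rule geom_convolution)
    fix a k
    have "e ^ (k + a) * e ^ a = e ^ k"
      by (rule power_parity[OF assms])
    then have "?W (k + a) a = - 4 * e ^ k * of_nat (k + a) * of_nat a"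
      by (simp add: algebra_simps)
    then show "?W (k + a) a = of_nat k * (e ^ k * of_nat k ^ 1)
        - of_nat (2 * a + k) * (e ^ (2 * a + k) * of_nat (2 * a + k) ^ 1)"
      unfolding power_parity[OF assms] by (simp add: algebra_simps)
  next
    fix a
    have "e ^ a * e ^ a = 1" "e ^ (2 * a) = 1"
      using power_parity(1)[OF assms, of a] power_parity(2)[OF assms, of a 0] by simp_all
    then show "?W a a = - (of_nat (2 * a) * (e ^ (2 * a) * of_nat (2 * a) ^ 1))"
      by (simp add: algebra_simps)
  qed (simp add: mult_ac)
  finally show "fps_nth (- 4 * (lambert_pow e 1 * lambert_pow e 1)) n = \<dots>" .
qed

lemma lambert_pow_mult:
  assumes "e ^ 2 = 1"
  shows "- 16 * (lambert_pow e 1 * lambert_pow e 3) = 2 * theta (lambert_pow e 3) -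
    lambert (\<lambda>k. of_nat (k + 1) * (of_nat k * (e ^ k * of_nat k ^ 3))
    + 2 * (\<Sum>j=1..<k. of_nat j * (e ^ j * of_nat j ^ 3)))"
proof (rule fps_ext)
  fix n
  let ?W = "\<lambda>a b. - 8 * (e ^ a * of_nat a ^ 1) * (e ^ b * of_nat b ^ 3)
    - 8 * (e ^ a * of_nat a ^ 3) * (e ^ b * of_nat b ^ 1)"
  have "- 16 * (lambert_pow e 1 * lambert_pow e 3) =
      - 8 * (lambert_pow e 1 * lambert_pow e 3) - 8 * (lambert_pow e 3 * lambert_pow e 1)"
    by (simp add: algebra_simps)
  then have "fps_nth (- 16 * (lambert_pow e 1 * lambert_pow e 3)) n
      = - 8 * fps_nth (lambert_pow e 1 * lambert_pow e 3) n - 8 * fps_nth (lambert_pow e 3 * lambert_pow e 1) n"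
    by (simp add: numeral_fps_const)
  also have "\<dots> = (\<Sum>a=1..n. \<Sum>b=1..n. ?W a b * fps_nth (geom a * geom b) n)"
    unfolding lambert_pow_def lambert_mult_nth sum_distrib_left sum_subtractf [symmetric]
    by (intro sum.cong refl) (simp add: algebra_simps)
  also have "\<dots> = fps_nth (2 * theta (lambert_pow e 3) -
    lambert (\<lambda>k. of_nat (k + 1) * (of_nat k * (e ^ k * of_nat k ^ 3))
    + 2 * (\<Sum>j=1..<k. of_nat j * (e ^ j * of_nat j ^ 3)))) n"
    unfolding lambert_pow_def
  proof (rule geom_convolution)
    fix a k
    have "e ^ (k + a) * e ^ a = e ^ k"
      by (rule power_parity[OF assms])
    moreover have "?W (k + a) a = - 8 * (e ^ (k + a) * e ^ a) *
        (of_nat (k + a) * of_nat a ^ 3 + of_nat (k + a) ^ 3 * of_nat a)"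
      by (simp add: algebra_simps)
    ultimately have "?W (k + a) a = - 8 * e ^ k *
        (of_nat (k + a) * of_nat a ^ 3 + of_nat (k + a) ^ 3 * of_nat a)"
      by simp
    then show "?W (k + a) a = of_nat k * (e ^ k * of_nat k ^ 3)
        - of_nat (2 * a + k) * (e ^ (2 * a + k) * of_nat (2 * a + k) ^ 3)"
      unfolding power_parity[OF assms] by (simp add: algebra_simps power3_eq_cube)
  next
    fix a
    have *: "e ^ a * e ^ a = 1" "e ^ (2 * a) = 1"
      using power_parity(1)[OF assms, of a] power_parity(2)[OF assms, of a 0] by simp_all
    have "?W a a = - 16 * (e ^ a * e ^ a) * of_nat a ^ 4"
      by (simp add: algebra_simps power3_eq_cube power4_eq_xxxx)
    then show "?W a a = - (of_nat (2 * a) * (e ^ (2 * a) * of_nat (2 * a) ^ 3))"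
      unfolding * by (simp add: algebra_simps power3_eq_cube power4_eq_xxxx)
  qed (simp add: mult_ac)
  finally show "fps_nth (- 16 * (lambert_pow e 1 * lambert_pow e 3)) n = \<dots>" .
qed

lemma power_sums:
  fixes k :: nat
  shows "6 * (\<Sum>j=1..<k. of_nat j * (1 ^ j * of_nat j ^ 1) :: complex) =
      2 * of_nat k ^ 3 - 3 * of_nat k ^ 2 + of_nat k"
    and "30 * (\<Sum>j=1..<k. of_nat j * (1 ^ j * of_nat j ^ 3) :: complex) =
      6 * of_nat k ^ 5 - 15 * of_nat k ^ 4 + 10 * of_nat k ^ 3 - of_nat k"
    and "k > 0 \<Longrightarrow> 2 * (\<Sum>j=1..<k. of_nat j * ((-1) ^ j * of_nat j ^ 1) :: complex) =
      (-1) ^ k * (of_nat k - of_nat k ^ 2)"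
    and "k > 0 \<Longrightarrow> 2 * (\<Sum>j=1..<k. of_nat j * ((-1) ^ j * of_nat j ^ 3) :: complex) =
      (-1) ^ k * (2 * of_nat k ^ 3 - of_nat k ^ 4 - of_nat k)"
proof (induction k)
  case (Suc k)
  { case 1 show ?case using Suc(1) by (cases "k = 0") (simp_all add: algebra_simps eval_nat_numeral) }
  { case 2 show ?case using Suc(2) by (cases "k = 0") (simp_all add: algebra_simps eval_nat_numeral) }
  { case 3 show ?case using Suc(3) by (cases "k = 0") (simp_all add: algebra_simps eval_nat_numeral) }
  { case 4 show ?case using Suc(4) by (cases "k = 0") (simp_all add: algebra_simps eval_nat_numeral) }
qed simp_all

lemma theta_lambert_pow:
  "6 * theta (lambert_pow 1 1) = 5 * lambert_pow 1 3 + lambert_pow 1 1 - 12 * lambert_pow 1 1 ^ 2"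
  "30 * theta (lambert_pow 1 3) = 21 * lambert_pow 1 5 + 10 * lambert_pow 1 3 - lambert_pow 1 1
    - 240 * lambert_pow 1 1 * lambert_pow 1 3"
  "2 * theta (lambert_pow (-1) 1) = lambert_pow (-1) 3 + lambert_pow (-1) 1 - 4 * lambert_pow (-1) 1 ^ 2"
  "2 * theta (lambert_pow (-1) 3) = lambert_pow (-1) 5 + 2 * lambert_pow (-1) 3 - lambert_pow (-1) 1
    - 16 * lambert_pow (-1) 1 * lambert_pow (-1) 3"
proof -
  let ?D = "\<lambda>e s k. of_nat (k + 1) * (of_nat k * (e ^ k * of_nat k ^ s))
    + 2 * (\<Sum>j=1..<k. of_nat j * (e ^ j * of_nat j ^ s)) :: complex"
  have "3 * lambert (?D 1 1) = lambert (\<lambda>k. 5 * (1 ^ k * of_nat k ^ 3) + 1 ^ k * of_nat k ^ 1)"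
    unfolding lambert_numeral_mult [symmetric]
    by (rule lambert_cong) (use power_sums(1) in \<open>simp add: algebra_simps eval_nat_numeral\<close>)
  then have D11: "3 * lambert (?D 1 1) = 5 * lambert_pow 1 3 + lambert_pow 1 1"
    unfolding lambert_pow_def lambert_add lambert_numeral_mult .
  have "15 * lambert (?D 1 3) = lambert (\<lambda>k. 21 * (1 ^ k * of_nat k ^ 5) + 10 * (1 ^ k * of_nat k ^ 3)
      - 1 ^ k * of_nat k ^ 1)"
    unfolding lambert_numeral_mult [symmetric]
    by (rule lambert_cong) (use power_sums(2) in \<open>simp add: algebra_simps eval_nat_numeral\<close>)
  then have D13: "15 * lambert (?D 1 3) = 21 * lambert_pow 1 5 + 10 * lambert_pow 1 3 - lambert_pow 1 1"
    unfolding lambert_pow_def lambert_add lambert_diff lambert_numeral_mult .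
  have "lambert (?D (-1) 1) = lambert (\<lambda>k. (-1) ^ k * of_nat k ^ 3 + (-1) ^ k * of_nat k ^ 1)"
    by (rule lambert_cong) (simp only: power_sums(3), simp add: algebra_simps eval_nat_numeral)
  then have Dm1: "lambert (?D (-1) 1) = lambert_pow (-1) 3 + lambert_pow (-1) 1"
    unfolding lambert_pow_def lambert_add .
  have "lambert (?D (-1) 3) = lambert (\<lambda>k. (-1) ^ k * of_nat k ^ 5 + 2 * ((-1) ^ k * of_nat k ^ 3)
      - (-1) ^ k * of_nat k ^ 1)"
    by (rule lambert_cong) (simp only: power_sums(4), simp add: algebra_simps eval_nat_numeral)
  then have Dm3: "lambert (?D (-1) 3) = lambert_pow (-1) 5 + 2 * lambert_pow (-1) 3 - lambert_pow (-1) 1"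
    unfolding lambert_pow_def lambert_add lambert_diff lambert_numeral_mult .
  have "6 * theta (lambert_pow 1 1) = 3 * (2 * theta (lambert_pow 1 1) - lambert (?D 1 1)) + 3 * lambert (?D 1 1)"
    by (simp add: algebra_simps)
  then show "6 * theta (lambert_pow 1 1) = 5 * lambert_pow 1 3 + lambert_pow 1 1 - 12 * lambert_pow 1 1 ^ 2"
    unfolding D11 by (subst (asm) lambert_pow_square [symmetric]) (simp_all add: algebra_simps power2_eq_square)
  have "30 * theta (lambert_pow 1 3) = 15 * (2 * theta (lambert_pow 1 3) - lambert (?D 1 3)) + 15 * lambert (?D 1 3)"
    by (simp add: algebra_simps)
  then show "30 * theta (lambert_pow 1 3) = 21 * lambert_pow 1 5 + 10 * lambert_pow 1 3 - lambert_pow 1 1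
    - 240 * lambert_pow 1 1 * lambert_pow 1 3"
    unfolding D13 by (subst (asm) lambert_pow_mult [symmetric]) (simp_all add: algebra_simps power2_eq_square)
  have "2 * theta (lambert_pow (-1) 1) = (2 * theta (lambert_pow (-1) 1) - lambert (?D (-1) 1)) + lambert (?D (-1) 1)"
    by (simp add: algebra_simps)
  then show "2 * theta (lambert_pow (-1) 1) = lambert_pow (-1) 3 + lambert_pow (-1) 1 - 4 * lambert_pow (-1) 1 ^ 2"
    unfolding Dm1 using lambert_pow_square[of "-1"] Dm1 by (simp add: algebra_simps power2_eq_square)
  show "2 * theta (lambert_pow (-1) 3) = lambert_pow (-1) 5 + 2 * lambert_pow (-1) 3 - lambert_pow (-1) 1
    - 16 * lambert_pow (-1) 1 * lambert_pow (-1) 3"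
    using lambert_pow_mult[of "-1"] Dm3 by (simp add: algebra_simps)
qed

subsection \<open>Differential equations for P, E, Q and R\<close>

instance fps :: (ring_char_0) ring_char_0 ..

definition dbl :: "complex fps \<Rightarrow> complex fps" where
  "dbl f = f oo fps_X ^ 2"

lemma dbl_nth: "fps_nth (dbl f) n = (if even n then fps_nth f (n div 2) else 0)"
  by (simp add: dbl_def fps_nth_compose_X_power)

lemma dbl_simps:
  "dbl (f + g) = dbl f + dbl g"
  "dbl (f - g) = dbl f - dbl g"
  "dbl (f * g) = dbl f * dbl g"
  "dbl (numeral w) = numeral w"
  by (auto simp: dbl_def fps_compose_add_distrib fps_compose_sub_distrib fps_compose_mult_distrib
      numeral_fps_const)

lemma theta_dbl: "theta (dbl f) = 2 * dbl (theta f)"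
  by (rule fps_ext) (auto simp: theta_nth dbl_nth numeral_fps_const elim!: evenE)

lemma lambert_pow_minus_1: "lambert_pow (-1) s = 2 ^ Suc s * dbl (lambert_pow 1 s) - lambert_pow 1 s"
proof (rule fps_ext)
  fix n
  have const: "(2 ^ Suc s :: complex fps) = fps_const (2 ^ Suc s)"
    by (simp only: fps_const_power [symmetric] numeral_fps_const)
  show "fps_nth (lambert_pow (-1) s) n = fps_nth (2 ^ Suc s * dbl (lambert_pow 1 s) - lambert_pow 1 s) n"
  proof (cases "n = 0")
    case False
    have "(\<Sum>d | d dvd n. (-1) ^ d * of_nat d ^ s) =
        (\<Sum>d | d dvd n. (if even d then 2 * of_nat d ^ s else 0) - of_nat d ^ s :: complex)"
      by (intro sum.cong) auto
    also have "\<dots> = (\<Sum>d | d dvd n \<and> even d. 2 * of_nat d ^ s) - (\<Sum>d | d dvd n. of_nat d ^ s)"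
      using False sum.inter_filter[of "{d. d dvd n}" "\<lambda>d. 2 * of_nat d ^ s :: complex" even]
      by (simp add: sum_subtractf)
    also have "(\<Sum>d | d dvd n \<and> even d. 2 * of_nat d ^ s :: complex) =
        (if even n then 2 ^ Suc s * (\<Sum>d | d dvd n div 2. of_nat d ^ s) else 0)"
    proof (cases "even n")
      case True
      then obtain m where m: "n = 2 * m" by (elim evenE)
      have "{d. d dvd n \<and> even d} = (\<lambda>d. 2 * d) ` {d. d dvd m}"
        by (auto simp: m elim!: evenE)
      then show ?thesis
        by (simp add: m sum.reindex inj_on_def sum_distrib_left power_mult_distrib mult_ac)
    next
      case False
      then have "{d. d dvd n \<and> even d} = {}" by (auto dest: dvd_trans)
      with False show ?thesis by (simp only: sum.empty if_False)
    qed
    finally show ?thesis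
      using False unfolding const by (auto simp: lambert_pow_def lambert_nth dbl_nth elim!: evenE)
  qed (unfold const, simp add: lambert_pow_def lambert_nth dbl_nth)
qed

definition serP :: "complex fps" where "serP = 1 - 8 * lambert_pow (-1) 1"
definition serE :: "complex fps" where "serE = 1 + 24 * (lambert_pow 1 1 - 2 * dbl (lambert_pow 1 1))"
definition serQ :: "complex fps" where "serQ = 1 + 16 * lambert_pow (-1) 3"
definition serR :: "complex fps" where "serR = 1 - 8 * lambert_pow (-1) 5"

text \<open>Here \<open>a\<close>, \<open>b\<close>, \<open>c\<close> are $\sum_d d^s q^d/(1-q^d)$ for $s = 1, 3, 5$, the letters
  \<open>x\<close>, \<open>y\<close>, \<open>z\<close> the same series at $q^2$, and primes denote the derivation $q\,d/dq$. Comparing the equation for \<open>P\<close> with those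
  for \<open>a\<close> and \<open>x\<close> yields $E^2$; differentiating the latter gives the second relation for
  \<open>b'\<close>, \<open>y'\<close> needed to express \<open>R\<close>.\<close>

lemma eisenstein_elimination:
  fixes a b x y a' x' :: "'a::{idom,ring_char_0}"
  assumes E: "E = 1 + 24 * (a - 2 * x)" and Q: "Q = 1 + 16 * (16 * y - b)"
    and P: "P = 1 - 8 * (4 * x - a)"
    and a': "6 * a' = 5 * b + a - 12 * a^2"
    and x': "3 * x' = 5 * y + x - 12 * x^2"
    and P': "2 * (4 * x' - a') = (16 * y - b) + (4 * x - a) - 4 * (4 * x - a)^2"
  shows "5 * E^2 = 5 + 240 * b + 960 * y" and "2 * (24 * (a' - 2 * x')) = P * E - Q"
  using assms by algebra+

lemma eisenstein_elimination':
  fixes a b c x y z b' y' e' :: "'a::{idom,ring_char_0}"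
  assumes E: "E = 1 + 24 * (a - 2 * x)" and Q: "Q = 1 + 16 * (16 * y - b)"
    and P: "P = 1 - 8 * (4 * x - a)"
    and E_sq: "5 * E^2 = 5 + 240 * b + 960 * y"
    and b': "30 * b' = 21 * c + 10 * b - a - 240 * a * b"
    and y': "15 * y' = 21 * z + 10 * y - x - 240 * x * y"
    and Q': "2 * (16 * y' - b') = (64 * z - c) + 2 * (16 * y - b) - (4 * x - a)
      - 16 * (4 * x - a) * (16 * y - b)"
    and e': "2 * e' = P * E - Q" "E * e' = 24 * (b' + 4 * y')"
  shows "1 - 8 * (64 * z - c) = E * Q"
  using assms by algebra

lemma serR_eq: "serR = serE * serQ"
  and theta_serP: "4 * theta serP = serP ^ 2 - serQ"
  and theta_serE: "2 * theta serE = serP * serE - serQ"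
  and theta_serQ: "theta serQ = serP * serQ - serR"
proof -
  define a b c where "a = lambert_pow 1 1" and "b = lambert_pow 1 3" and "c = lambert_pow 1 5"
  define x y z where "x = dbl a" and "y = dbl b" and "z = dbl c"
  note a' = theta_lambert_pow(1)[folded a_def b_def]
  note b' = theta_lambert_pow(2)[folded a_def b_def c_def]
  have "6 * dbl (theta a) = 5 * y + x - 12 * x ^ 2" "30 * dbl (theta b) = 21 * z + 10 * y - x - 240 * x * y"
    using arg_cong[OF a', of dbl] arg_cong[OF b', of dbl]
    by (simp_all add: dbl_simps power2_eq_square x_def y_def z_def)
  then have x': "3 * theta x = 5 * y + x - 12 * x ^ 2"
    and y': "15 * theta y = 21 * z + 10 * y - x - 240 * x * y"
    by (simp_all add: x_def y_def theta_dbl)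
  have Lm: "lambert_pow (-1) 1 = 4 * x - a" "lambert_pow (-1) 3 = 16 * y - b" "lambert_pow (-1) 5 = 64 * z - c"
    by (simp_all only: lambert_pow_minus_1 x_def y_def z_def a_def b_def c_def) simp_all
  have E: "serE = 1 + 24 * (a - 2 * x)" and P: "serP = 1 - 8 * (4 * x - a)"
    and Q: "serQ = 1 + 16 * (16 * y - b)" and R: "serR = 1 - 8 * (64 * z - c)"
    unfolding serE_def serP_def serQ_def serR_def Lm by (simp_all add: x_def a_def)
  have P': "2 * (4 * theta x - theta a) = (16 * y - b) + (4 * x - a) - 4 * (4 * x - a) ^ 2"
    and Q': "2 * (16 * theta y - theta b) = (64 * z - c) + 2 * (16 * y - b) - (4 * x - a)
      - 16 * (4 * x - a) * (16 * y - b)"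
    using theta_lambert_pow(3,4) unfolding Lm by (simp_all add: theta_simps)
  note elim = eisenstein_elimination[OF E Q P a' x' P']
  have thE: "theta serE = 24 * (theta a - 2 * theta x)"
    by (simp add: E theta_simps)
  then show 1: "2 * theta serE = serP * serE - serQ"
    using elim(2) by simp
  have "10 * (serE * theta serE) = 10 * (24 * (theta b + 4 * theta y))"
    using arg_cong[OF elim(1), of theta]
    by (simp add: theta_simps power2_eq_square algebra_simps)
  then have "serE * theta serE = 24 * (theta b + 4 * theta y)"
    by (metis mult_left_cancel numeral_neq_fps_zero)
  from eisenstein_elimination'[OF E Q P elim(1) b' y' Q' 1 this]
  show "serR = serE * serQ"
    unfolding R .
  have "4 * theta serP = - 16 * (2 * (4 * theta x - theta a))"
    by (simp add: P theta_simps algebra_simps)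
  also have "\<dots> = serP ^ 2 - serQ"
    unfolding P' P Q by (simp add: algebra_simps power2_eq_square)
  finally show "4 * theta serP = serP ^ 2 - serQ" .
  have "theta serQ = 8 * (2 * (16 * theta y - theta b))"
    by (simp add: Q theta_simps algebra_simps)
  also have "\<dots> = serP * serQ - serR"
    unfolding Q' P Q R by (simp add: algebra_simps)
  finally show "theta serQ = serP * serQ - serR" .
qed

subsection \<open>The series psi\<close>

definition tri :: "nat \<Rightarrow> nat" where "tri k = k * (k + 1) div 2"

lemma tri_0 [simp]: "tri 0 = 0"
  by (simp add: tri_def)

lemma tri_Suc [simp]: "tri (Suc k) = tri k + Suc k"
  by (simp add: tri_def)

lemma strict_mono_tri: "strict_mono tri"
  by (simp add: strict_mono_Suc_iff)

lemma le_tri: "k \<le> tri k"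
  by (rule strict_mono_imp_increasing[OF strict_mono_tri])

lemma eight_tri: "8 * tri k + 1 = (2 * k + 1) ^ 2"
  by (induction k) (simp_all add: power2_eq_square)

lemma tri_eq_iff [simp]: "tri k = tri l \<longleftrightarrow> k = l"
  using strict_mono_eq[OF strict_mono_tri] .

definition ser_psi :: "nat \<Rightarrow> complex fps" where
  "ser_psi n = Abs_fps (\<lambda>m. \<Sum>k | tri k = m. of_nat (2 * k + 1) ^ n)"

lemma ser_psi_nth_tri: "fps_nth (ser_psi n) (tri k) = of_nat (2 * k + 1) ^ n"
  by (simp add: ser_psi_def)

lemma ser_psi_nth_0: "m \<notin> range tri \<Longrightarrow> fps_nth (ser_psi n) m = 0"
  by (auto simp: ser_psi_def intro!: sum.neutral)

lemma ser_psi_step: "ser_psi (n + 2) = ser_psi n + 8 * theta (ser_psi n)"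
proof (rule fps_ext)
  fix m
  show "fps_nth (ser_psi (n + 2)) m = fps_nth (ser_psi n + 8 * theta (ser_psi n)) m"
  proof (cases "m \<in> range tri")
    case True
    then obtain k where m: "m = tri k" by auto
    have "8 * of_nat (tri k) + 1 = (of_nat (2 * k + 1) ^ 2 :: complex)"
      using arg_cong[OF eight_tri[of k], of "of_nat :: nat \<Rightarrow> complex"]
      by (simp only: of_nat_add of_nat_mult of_nat_power of_nat_numeral of_nat_1)
    then have "of_nat (2 * k + 1) ^ (n + 2) = (8 * of_nat (tri k) + 1) * (of_nat (2 * k + 1) ^ n :: complex)"
      by (simp only: power_add mult.commute)
    then show ?thesis
      unfolding m fps_add_nth numeral_fps_const fps_mult_left_const_nth theta_nth ser_psi_nth_tri
      by (simp only: distrib_right mult_1_left mult.assoc add.commute)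
  qed (simp add: ser_psi_nth_0 theta_nth numeral_fps_const)
qed

text \<open>Shanks' finite form of Gauss' product for $\sum_k q^{k(k+1)/2}$: every summand with
  \<open>s > 0\<close> on the right is divisible by $x^{2n+1}$, so the product \<open>r 0 n\<close> agrees with the theta
  series up to that order.\<close>

lemma shanks:
  fixes x :: "'a::comm_ring_1"
  assumes iv: "\<And>k. iv k * (1 - x ^ (2 * k + 1)) = 1"
  defines "r \<equiv> \<lambda>s n. \<Prod>k=s..<n. (1 - x ^ (2 * k + 2)) * iv k"
  shows "(\<Sum>s<2*n. x ^ tri s) = (\<Sum>s<n. r s n * x ^ (s * (2 * n + 1)))"
proof (induction n)
  case (Suc n)
  define w where "w s = r s n * (1 - x ^ (2 * s)) * x ^ (s * (2 * n + 1)) * iv n" for s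
  have r_Suc: "r s (Suc n) = r s n * ((1 - x ^ (2 * n + 2)) * iv n)" if "s \<le> n" for s
    using that by (simp add: r_def)
  have r_head: "r s n = (1 - x ^ (2 * s + 2)) * iv s * r (Suc s) n" if "s < n" for s
    using that unfolding r_def by (rule prod.atLeast_Suc_lessThan)
  have step: "r s (Suc n) * x ^ (s * (2 * Suc n + 1)) - r s n * x ^ (s * (2 * n + 1)) = w (Suc s) - w s"
    if "s < n" for s
  proof -
    define y where "y = x ^ (s * (2 * n + 1))"
    have "r (Suc s) n * (1 - x ^ (2 * Suc s)) = r s n * (1 - x ^ (2 * s + 1))"
    proof -
      have "r s n * (1 - x ^ (2 * s + 1)) = r (Suc s) n * (1 - x ^ (2 * s + 2)) * (iv s * (1 - x ^ (2 * s + 1)))"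
        unfolding r_head[OF that] by (simp only: mult_ac)
      then show ?thesis unfolding iv by simp
    qed
    then have w: "w (Suc s) = r s n * iv n * y * (x ^ (2 * n + 1) * (1 - x ^ (2 * s + 1)))"
      unfolding w_def y_def by (simp add: power_add mult_ac)
    have "r s (Suc n) * x ^ (s * (2 * Suc n + 1)) = r s n * iv n * y * (x ^ (2 * s) * (1 - x ^ (2 * n + 2)))"
    proof -
      have "x ^ (s * (2 * Suc n + 1)) = y * x ^ (2 * s)"
        unfolding y_def power_add [symmetric] by (simp add: algebra_simps)
      then show ?thesis using that by (simp only: r_Suc less_imp_le mult_ac)
    qed
    moreover have "r s n * y = r s n * iv n * y * (1 - x ^ (2 * n + 1))"
    proof -
      have "r s n * y = r s n * y * (iv n * (1 - x ^ (2 * n + 1)))"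
        unfolding iv by simp
      then show ?thesis by (simp only: mult_ac)
    qed
    ultimately have "r s (Suc n) * x ^ (s * (2 * Suc n + 1)) - r s n * y
        = r s n * iv n * y * (x ^ (2 * s) * (1 - x ^ (2 * n + 2)) - (1 - x ^ (2 * n + 1)))"
      by (simp only: right_diff_distrib)
    also have "x ^ (2 * s) * (1 - x ^ (2 * n + 2)) - (1 - x ^ (2 * n + 1))
        = x ^ (2 * n + 1) * (1 - x ^ (2 * s + 1)) - (1 - x ^ (2 * s))"
      by (simp add: algebra_simps power_add)
    also have "r s n * iv n * y * \<dots> = w (Suc s) - w s"
    proof -
      have "w s = r s n * iv n * y * (1 - x ^ (2 * s))"
        by (simp only: w_def y_def mult_ac)
      then show ?thesis
        unfolding w by (simp only: right_diff_distrib)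
    qed
    finally show ?thesis unfolding y_def .
  qed
  have "(\<Sum>s<n. w (Suc s) - w s)
      = (\<Sum>s<n. r s (Suc n) * x ^ (s * (2 * Suc n + 1))) - (\<Sum>s<n. r s n * x ^ (s * (2 * n + 1)))"
    unfolding sum_subtractf [symmetric] by (intro sum.cong refl step [symmetric]) simp
  then have "(\<Sum>s<Suc n. r s (Suc n) * x ^ (s * (2 * Suc n + 1)))
      = (\<Sum>s<n. r s n * x ^ (s * (2 * n + 1))) + (\<Sum>s<n. w (Suc s) - w s)
        + r n (Suc n) * x ^ (n * (2 * Suc n + 1))"
    by (simp only: sum.lessThan_Suc) simp
  also have "(\<Sum>s<n. w (Suc s) - w s) = w n"
    by (subst sum_lessThan_telescope) (simp add: w_def)
  also have "r n (Suc n) * x ^ (n * (2 * Suc n + 1))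
      = x ^ (n * (2 * n + 1)) * iv n * (x ^ (2 * n) * (1 - x ^ (2 * n + 2)))"
  proof -
    have "x ^ (n * (2 * Suc n + 1)) = x ^ (n * (2 * n + 1)) * x ^ (2 * n)"
      unfolding power_add [symmetric] by (simp add: algebra_simps)
    moreover have "r n (Suc n) = (1 - x ^ (2 * n + 2)) * iv n"
      by (simp add: r_def)
    ultimately show ?thesis by (simp only: mult_ac)
  qed
  also have "(\<Sum>s<n. r s n * x ^ (s * (2 * n + 1))) + w n + \<dots> =
     (\<Sum>s<2*n. x ^ tri s) + x ^ (n * (2 * n + 1)) * (1 + x ^ (2 * n + 1)) * (iv n * (1 - x ^ (2 * n + 1)))"
  proof -
    define y where "y = x ^ (n * (2 * n + 1))"
    have "w n = y * iv n * (1 - x ^ (2 * n))"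
      by (simp add: w_def r_def y_def mult_ac)
    moreover have "y * iv n * (1 - x ^ (2 * n)) + y * iv n * (x ^ (2 * n) * (1 - x ^ (2 * n + 2)))
        = y * iv n * ((1 + x ^ (2 * n + 1)) * (1 - x ^ (2 * n + 1)))"
      unfolding distrib_left [symmetric] by (simp add: algebra_simps flip: power_add)
    ultimately show ?thesis
      unfolding Suc y_def [symmetric] by (simp only: add.assoc mult_ac)
  qed
  also have "\<dots> = (\<Sum>s<2*Suc n. x ^ tri s)"
  proof -
    have "tri (2 * n) = n * (2 * n + 1)" "tri (Suc (2 * n)) = n * (2 * n + 1) + (2 * n + 1)"
      by (simp_all add: tri_def)
    moreover have "(\<Sum>s<2*Suc n. x ^ tri s) =
        (\<Sum>s<2*n. x ^ tri s) + x ^ tri (2 * n) + x ^ tri (Suc (2 * n))"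
      by (simp del: tri_Suc)
    ultimately show ?thesis
      unfolding iv by (simp only: power_add distrib_left mult_1_right add.assoc mult.assoc)
  qed
  finally show ?case by simp
qed simp

lemma theta_one_minus_X_power:
  assumes "m > 0"
  shows "theta (1 - fps_X ^ m) = - (of_nat m * geom m) * (1 - fps_X ^ m)"
proof -
  have "theta (1 - fps_X ^ m) = - (of_nat m * (geom m * (1 - fps_X ^ m)))"
    unfolding geom_eq[OF assms] by (simp add: theta_simps theta_X_power)
  then show ?thesis by (simp only: mult_minus_left mult.assoc)
qed

lemma inverse_one_minus_X_power:
  assumes "m > 0"
  shows "inverse (1 - fps_X ^ m) * (1 - fps_X ^ m) = (1 :: complex fps)"
  using assms by (intro inverse_mult_eq_1) simp

lemma theta_inverse_one_minus_X_power:
  assumes "m > 0"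
  shows "theta (inverse (1 - fps_X ^ m)) = of_nat m * geom m * inverse (1 - fps_X ^ m)"
proof -
  let ?i = "inverse (1 - fps_X ^ m) :: complex fps"
  have "theta (?i * (1 - fps_X ^ m)) = 0"
    unfolding inverse_one_minus_X_power[OF assms] by (rule theta_simps)
  then have "(theta ?i - of_nat m * geom m * ?i) * (1 - fps_X ^ m) = 0"
    unfolding theta_simps(3) theta_one_minus_X_power[OF assms] by (simp add: algebra_simps)
  then show ?thesis
    using one_minus_X_power_neq_0[OF assms] by (metis mult_eq_0_iff right_minus_eq)
qed

definition gauss_prod :: "nat \<Rightarrow> complex fps" where
  "gauss_prod n = (\<Prod>k=0..<n. (1 - fps_X ^ (2 * k + 2)) * inverse (1 - fps_X ^ (2 * k + 1)))"

lemma theta_gauss_prod: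
  "theta (gauss_prod n) = gauss_prod n *
    (\<Sum>k<n. of_nat (2 * k + 1) * geom (2 * k + 1) - of_nat (2 * k + 2) * geom (2 * k + 2))"
proof (induction n)
  case 0
  show ?case by (simp add: gauss_prod_def theta_simps)
next
  case (Suc n)
  let ?u = "1 - fps_X ^ (2 * n + 2) :: complex fps" and ?v = "inverse (1 - fps_X ^ (2 * n + 1)) :: complex fps"
  have uv: "theta ?u = - (of_nat (2 * n + 2) * geom (2 * n + 2)) * ?u"
    "theta ?v = of_nat (2 * n + 1) * geom (2 * n + 1) * ?v"
    by (rule theta_one_minus_X_power theta_inverse_one_minus_X_power, simp)+
  have "gauss_prod (Suc n) = gauss_prod n * (?u * ?v)"
    by (simp add: gauss_prod_def)
  moreover have "p * S * (u * v) + p * (- b * u * v + u * (a * v)) = p * (u * v) * (S + (a - b))"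
    for p S u v a b :: "complex fps"
    by (simp add: algebra_simps)
  ultimately show ?case
    by (simp only: theta_simps(3) Suc uv sum.lessThan_Suc)
qed

lemma lambert_nth_pairs:
  assumes "j \<le> 2 * n"
  shows "fps_nth (- lambert_pow (-1) 1) j =
    fps_nth (\<Sum>k<n. of_nat (2 * k + 1) * geom (2 * k + 1) - of_nat (2 * k + 2) * geom (2 * k + 2)) j"
proof -
  have "fps_nth (- lambert_pow (-1) 1) j = - (\<Sum>k=1..2*n. (-1) ^ k * of_nat k * fps_nth (geom k) j)"
    using assms by (simp add: lambert_pow_def lambert_nth_geom[of j "2 * n"])
  also have "\<dots> = (\<Sum>k<n. of_nat (2 * k + 1) * fps_nth (geom (2 * k + 1)) j
      - of_nat (2 * k + 2) * fps_nth (geom (2 * k + 2)) j)"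
    by (induction n) (simp_all add: algebra_simps)
  finally show ?thesis
    by (simp add: fps_sum_nth fps_mult_left_const_nth flip: fps_of_nat)
qed

lemma ser_psi_0_nth:
  assumes "j < 2 * n"
  shows "fps_nth (ser_psi 0) j = fps_nth (gauss_prod n) j"
proof -
  let ?iv = "\<lambda>k. inverse (1 - fps_X ^ (2 * k + 1)) :: complex fps"
  let ?r = "\<lambda>s n. \<Prod>k=s..<n. (1 - fps_X ^ (2 * k + 2)) * ?iv k"
  have n: "0 < n" using assms by simp
  have "fps_nth (ser_psi 0) j = fps_nth (\<Sum>s<2*n. fps_X ^ tri s) j"
  proof -
    have "{k. tri k = j} = {s \<in> {..<2 * n}. j = tri s}"
      using assms by (auto intro: le_less_trans[OF le_tri])
    then show ?thesis
      by (simp add: ser_psi_def fps_sum_nth sum.inter_filter [symmetric])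
  qed
  also have "(\<Sum>s<2*n. fps_X ^ tri s) = (\<Sum>s<n. ?r s n * fps_X ^ (s * (2 * n + 1)))"
    by (rule shanks) (rule inverse_one_minus_X_power, simp)
  also have "fps_nth \<dots> j = (\<Sum>s<n. if s = 0 then fps_nth (?r s n) j else 0)"
  proof -
    have "fps_nth (?r s n * fps_X ^ (s * (2 * n + 1))) j = (if s = 0 then fps_nth (?r s n) j else 0)" for s
    proof (cases "s = 0")
      case False
      then have "j < s * (2 * n + 1)"
        using assms by (cases s) auto
      with False show ?thesis by (simp only: fps_X_power_mult_right_nth if_True if_False)
    qed simp
    then show ?thesis by (simp only: fps_sum_nth)
  qed
  also have "\<dots> = fps_nth (gauss_prod n) j"
    using n by (simp add: gauss_prod_def)
  finally show ?thesis .
qed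

lemma theta_ser_psi_0: "theta (ser_psi 0) = - lambert_pow (-1) 1 * ser_psi 0"
proof (rule fps_ext)
  fix j
  let ?S = "\<Sum>k<Suc j. of_nat (2 * k + 1) * geom (2 * k + 1) - of_nat (2 * k + 2) * geom (2 * k + 2)"
  have "fps_nth (theta (ser_psi 0)) j = fps_nth (theta (gauss_prod (Suc j))) j"
    by (simp add: theta_nth ser_psi_0_nth[of j "Suc j"])
  also have "\<dots> = fps_nth (?S * gauss_prod (Suc j)) j"
    by (simp only: theta_gauss_prod mult.commute)
  also have "\<dots> = fps_nth (- lambert_pow (-1) 1 * ser_psi 0) j"
    unfolding fps_mult_nth
  proof (intro sum.cong refl arg_cong2[where f = "(*)"])
    fix i assume "i \<in> {0..j}"
    then show "fps_nth ?S i = fps_nth (- lambert_pow (-1) 1) i"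
      by (intro lambert_nth_pairs [symmetric]) simp
    show "fps_nth (gauss_prod (Suc j)) (j - i) = fps_nth (ser_psi 0) (j - i)"
      by (intro ser_psi_0_nth [symmetric]) simp
  qed
  finally show "fps_nth (theta (ser_psi 0)) j = fps_nth (- lambert_pow (-1) 1 * ser_psi 0) j" .
qed

subsection \<open>Convergence\<close>

lemma fps_conv_radius_ge_1:
  fixes f :: "complex fps"
  assumes "\<And>n. norm (fps_nth f n) \<le> c * of_nat (n + 1) ^ m"
  shows "fps_conv_radius f \<ge> 1"
  unfolding fps_conv_radius_def
proof (rule conv_radius_geI_ex')
  fix r :: real assume r: "0 < r" "ereal r < 1"
  have "(\<lambda>n. (real (n + 1) / real (n + 2)) ^ m) \<longlonglongrightarrow> 1 ^ m"
  proof (rule tendsto_power)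
    have "(\<lambda>n. real (n + 1) / real (n + 2)) = (\<lambda>n. real (Suc n) / real (Suc (Suc n)))" by simp
    then show "(\<lambda>n. real (n + 1) / real (n + 2)) \<longlonglongrightarrow> 1"
      using LIMSEQ_Suc[OF LIMSEQ_n_over_Suc_n] by simp
  qed
  then have "conv_radius (\<lambda>n. real (n + 1) ^ m) = ereal 1"
    by (intro conv_radius_ratio_limit_nonzero[where c = 1]) (simp_all add: power_divide add.commute)
  then have "summable (\<lambda>n. real (n + 1) ^ m * r ^ n)"
    using r by (intro summable_in_conv_radius) simp
  then have "summable (\<lambda>n. c * (real (n + 1) ^ m * r ^ n))"
    by (rule summable_mult)
  then show "summable (\<lambda>n. fps_nth f n * of_real r ^ n)"
  proof (rule summable_comparison_test')
    fix n
    show "norm (fps_nth f n * of_real r ^ n) \<le> c * (real (n + 1) ^ m * r ^ n)"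
      using mult_right_mono[OF assms[of n], of "r ^ n"] r
      by (simp add: norm_mult norm_power mult.assoc)
  qed
qed

lemma less_fps_conv_radius:
  "fps_conv_radius f \<ge> 1 \<Longrightarrow> norm q < 1 \<Longrightarrow> ereal (norm q) < fps_conv_radius f"
  by (rule less_le_trans[of _ 1]) (simp_all add: one_ereal_def)

lemma norm_lambert_pow_nth:
  assumes "norm e = 1"
  shows "norm (fps_nth (lambert_pow e s) n) \<le> 1 * of_nat (n + 1) ^ (s + 1)"
proof (cases "n = 0")
  case False
  have "norm (\<Sum>d | d dvd n. e ^ d * of_nat d ^ s) \<le> (\<Sum>d | d dvd n. real (n + 1) ^ s)"
  proof (rule sum_norm_le)
    fix d assume "d \<in> {d. d dvd n}"
    then have "d \<le> n" using False by (auto intro: dvd_imp_le)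
    then show "norm (e ^ d * of_nat d ^ s) \<le> real (n + 1) ^ s"
      using assms by (auto simp: norm_mult norm_power intro!: power_mono)
  qed
  also have "\<dots> \<le> real (n + 1) * real (n + 1) ^ s"
  proof -
    have "card {d. d dvd n} \<le> card {1..n}"
      using False by (intro card_mono) (auto intro: dvd_imp_le Nat.gr0I)
    then show ?thesis by (simp add: mult_right_mono)
  qed
  finally show ?thesis using False by (simp add: lambert_pow_def lambert_nth)
qed (simp add: lambert_pow_def lambert_nth)

lemma conv_radius_lambert_pow: "norm e = 1 \<Longrightarrow> fps_conv_radius (lambert_pow e s) \<ge> 1"
  by (rule fps_conv_radius_ge_1, rule norm_lambert_pow_nth)

lemma conv_radius_ser_psi: "fps_conv_radius (ser_psi n) \<ge> 1"
proof (rule fps_conv_radius_ge_1)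
  fix m
  show "norm (fps_nth (ser_psi n) m) \<le> 2 ^ n * of_nat (m + 1) ^ n"
  proof (cases "m \<in> range tri")
    case True
    then obtain k where m: "m = tri k" by auto
    have "real (2 * k + 1) \<le> 2 * real (m + 1)"
      using le_tri[of k] unfolding m by simp
    then have "real (2 * k + 1) ^ n \<le> (2 * real (m + 1)) ^ n"
      by (rule power_mono) simp
    then show ?thesis
      unfolding m ser_psi_nth_tri norm_power norm_of_nat power_mult_distrib .
  qed (simp add: ser_psi_nth_0)
qed

lemma psi_eq_eval:
  assumes "norm q < 1"
  shows "psi n q = eval_fps (ser_psi n) q"
proof -
  have "(\<lambda>m. fps_nth (ser_psi n) m * q ^ m) sums eval_fps (ser_psi n) q"
    by (intro sums_eval_fps less_fps_conv_radius conv_radius_ser_psi assms)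
  then have "(\<lambda>k. fps_nth (ser_psi n) (tri k) * q ^ tri k) sums eval_fps (ser_psi n) q"
    by (subst sums_mono_reindex[OF strict_mono_tri, where f = "\<lambda>m. fps_nth (ser_psi n) m * q ^ m"])
      (simp_all add: ser_psi_nth_0)
  then show ?thesis
    unfolding psi_def tri_def [symmetric] ser_psi_nth_tri by (rule sums_unique [symmetric])
qed

lemma psi_0_nonzero:
  assumes "norm q < 1"
  shows "psi 0 q \<noteq> 0"
proof -
  define H where "H = Abs_fps (\<lambda>n. fps_nth (- lambert_pow (-1) 1) n / of_nat n)"
  have "theta H = - lambert_pow (-1) 1"
    by (rule fps_ext) (simp add: theta_nth H_def lambert_pow_def lambert_nth)
  then have "fps_X * fps_deriv (ser_psi 0) = fps_X * (fps_deriv H * ser_psi 0)"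
    using theta_ser_psi_0 unfolding theta_def by (metis mult.assoc)
  then have deriv: "fps_deriv (ser_psi 0) = fps_deriv H * ser_psi 0"
    by simp
  have "fps_conv_radius H \<ge> 1"
  proof (rule fps_conv_radius_ge_1)
    fix n
    have "norm (fps_nth H n) = norm (fps_nth (lambert_pow (-1) 1) n) / real n"
      by (simp add: H_def norm_divide)
    also have "\<dots> \<le> norm (fps_nth (lambert_pow (-1) 1) n)"
      using divide_left_mono[of 1 "real n" "norm (fps_nth (lambert_pow (-1) 1) n)"] by (cases "n = 0") simp_all
    also note norm_lambert_pow_nth[of "-1" 1 n]
    finally show "norm (fps_nth H n) \<le> 1 * of_nat (n + 1) ^ (1 + 1)" by simp
  qed
  then have rad: "ereal (norm z) < fps_conv_radius H" "ereal (norm z) < fps_conv_radius (ser_psi 0)"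
    "ereal (norm z) < fps_conv_radius (fps_deriv H)"
    if "norm z < 1" for z :: complex
    using that conv_radius_ser_psi[of 0] order.trans[OF _ fps_conv_radius_deriv[of H]]
    by (auto intro!: less_fps_conv_radius)
  define F where "F z = exp (- eval_fps H z) * eval_fps (ser_psi 0) z" for z
  have "\<exists>c. \<forall>z\<in>ball 0 1. F z = c"
  proof (rule has_field_derivative_zero_constant)
    fix z :: complex assume "z \<in> ball 0 1"
    then have z: "norm z < 1" by simp
    have "eval_fps (fps_deriv (ser_psi 0)) z = eval_fps (fps_deriv H) z * eval_fps (ser_psi 0) z"
      unfolding deriv by (rule eval_fps_mult) (use rad[OF z] in auto)
    then show "(F has_field_derivative 0) (at z within ball 0 1)"
      unfolding F_def
      by (auto intro!: derivative_eq_intros has_field_derivative_eval_fps rad[OF z])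
  qed simp
  then obtain c where c: "\<And>z. norm z < 1 \<Longrightarrow> F z = c" by auto
  have "F 0 = 1"
    using ser_psi_nth_tri[of 0 0] by (simp add: F_def eval_fps_at_0 H_def)
  then have "F q = 1"
    using c[of 0] c[OF assms] by simp
  then show ?thesis
    using psi_eq_eval[OF assms] by (auto simp: F_def)
qed

lemma conv_radius_ge_1_arith:
  fixes f g :: "complex fps"
  assumes "fps_conv_radius f \<ge> 1" "fps_conv_radius g \<ge> 1"
  shows "fps_conv_radius (f + g) \<ge> 1" "fps_conv_radius (f - g) \<ge> 1" "fps_conv_radius (f * g) \<ge> 1"
  using assms fps_conv_radius_add[of f g] fps_conv_radius_diff[of f g] fps_conv_radius_mult[of f g]
  by (auto intro: order.trans[OF min.boundedI])

lemma conv_radius_ge_1_power: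
  fixes f :: "complex fps"
  shows "fps_conv_radius f \<ge> 1 \<Longrightarrow> fps_conv_radius (f ^ n) \<ge> 1"
  by (rule order.trans[OF _ fps_conv_radius_power])

lemma sigma_hat_sum:
  assumes "n > 0"
  shows "(\<Sum>d | d dvd n. (-1) ^ (n div d - 1) * of_nat d ^ s) =
    fps_nth (lambert_pow 1 s - 2 * dbl (lambert_pow 1 s)) n"
proof -
  have "(\<Sum>d | d dvd n. (-1) ^ (n div d - 1) * of_nat d ^ s :: complex) =
      (\<Sum>d | d dvd n. of_nat d ^ s - (if even (n div d) then 2 * of_nat d ^ s else 0))"
  proof (intro sum.cong refl)
    fix d assume "d \<in> {d. d dvd n}"
    then have "n div d > 0"
      using assms by (auto elim!: dvdE)
    then show "(-1) ^ (n div d - 1) * of_nat d ^ s =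
        (of_nat d ^ s - (if even (n div d) then 2 * of_nat d ^ s else 0) :: complex)"
      by (cases "n div d") auto
  qed
  also have "\<dots> = (\<Sum>d | d dvd n. of_nat d ^ s) - (\<Sum>d | d dvd n \<and> even (n div d). 2 * of_nat d ^ s)"
    using assms sum.inter_filter[of "{d. d dvd n}" "\<lambda>d. 2 * of_nat d ^ s :: complex" "\<lambda>d. even (n div d)"]
    by (simp add: sum_subtractf)
  also have "{d. d dvd n \<and> even (n div d)} = (if even n then {d. d dvd n div 2} else {})"
  proof (intro set_eqI iffI)
    fix d assume "d \<in> {d. d dvd n \<and> even (n div d)}"
    then have "d dvd n" and even: "even (n div d)"
      by auto
    then obtain k where k: "n = d * k"
      by (elim dvdE)
    then have "even k"
      using assms even by simp
    then show "d \<in> (if even n then {d. d dvd n div 2} else {})"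
      unfolding k by (auto elim!: evenE)
  next
    fix d assume "d \<in> (if even n then {d. d dvd n div 2} else {})"
    then have "even n" "d dvd n div 2"
      by (auto split: if_splits)
    then obtain k where "n = 2 * (n div 2)" "n div 2 = d * k"
      by (metis dvdE dvd_mult_div_cancel)
    then have "n = d * (2 * k)"
      by simp
    then show "d \<in> {d. d dvd n \<and> even (n div d)}"
      using assms by simp
  qed
  finally show ?thesis
    using assms by (auto simp: lambert_pow_def lambert_nth dbl_nth sum_distrib_left numeral_fps_const elim!: evenE)
qed

lemma sigma_tilde_sum:
  assumes "n > 0"
  shows "(\<Sum>d | d dvd n. (-1) ^ (d - 1) * of_nat d ^ s) = - fps_nth (lambert_pow (-1) s) n"
proof -
  have "(\<Sum>d | d dvd n. (-1) ^ (d - 1) * of_nat d ^ s) =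
      (\<Sum>d | d dvd n. - ((-1) ^ d * of_nat d ^ s) :: complex)"
  proof (intro sum.cong refl)
    fix d assume "d \<in> {d. d dvd n}"
    then have "d > 0" using assms by (auto intro: Nat.gr0I)
    then show "(-1) ^ (d - 1) * of_nat d ^ s = - ((-1) ^ d * of_nat d ^ s :: complex)"
      by (cases d) auto
  qed
  then show ?thesis
    using assms by (simp add: lambert_pow_def lambert_nth sum_negf)
qed

lemma cal_eq_eval:
  "calP q = eval_fps serP q" "calE q = eval_fps serE q"
  "calQ q = eval_fps serQ q" "calR q = eval_fps serR q"
proof -
  have lambert_pow_0: "fps_nth (lambert_pow e s) 0 = 0" for e s
    by (simp add: lambert_pow_def lambert_nth)
  have "8 * sigma_tilde 1 n = fps_nth serP n" "24 * sigma_hat 1 n = fps_nth serE n"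
    "- 16 * sigma_tilde 3 n = fps_nth serQ n" "8 * sigma_tilde 5 n = fps_nth serR n" for n
    using sigma_tilde_sum[of n 1] sigma_tilde_sum[of n 3] sigma_tilde_sum[of n 5] sigma_hat_sum[of n 1]
    by (auto simp: sigma_tilde_def sigma_hat_def serP_def serE_def serQ_def serR_def
        numeral_fps_const lambert_pow_0 dbl_nth)
  then show "calP q = eval_fps serP q" "calE q = eval_fps serE q"
    "calQ q = eval_fps serQ q" "calR q = eval_fps serR q"
    by (simp_all only: calP_def calE_def calQ_def calR_def eval_fps_def)
qed

lemma conv_radius_dbl:
  assumes "\<And>n. norm (fps_nth f n) \<le> of_nat (n + 1) ^ m"
  shows "fps_conv_radius (dbl f) \<ge> 1"
proof (rule fps_conv_radius_ge_1[where c = 1 and m = m])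
  fix n
  have "norm (fps_nth (dbl f) n) \<le> real (n div 2 + 1) ^ m"
    using assms[of "n div 2"] by (simp add: dbl_nth)
  also have "\<dots> \<le> real (n + 1) ^ m"
    by (rule power_mono) simp_all
  finally show "norm (fps_nth (dbl f) n) \<le> 1 * of_nat (n + 1) ^ m"
    by simp
qed

lemma conv_radius_ser:
  "fps_conv_radius serP \<ge> 1" "fps_conv_radius serE \<ge> 1"
  "fps_conv_radius serQ \<ge> 1" "fps_conv_radius serR \<ge> 1"
proof -
  have "fps_conv_radius (dbl (lambert_pow 1 1)) \<ge> 1"
    using norm_lambert_pow_nth[of 1 1] by (intro conv_radius_dbl[where m = 2]) (simp add: numeral_2_eq_2)
  then show "fps_conv_radius serP \<ge> 1" "fps_conv_radius serE \<ge> 1"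
    "fps_conv_radius serQ \<ge> 1" "fps_conv_radius serR \<ge> 1"
    unfolding serP_def serE_def serQ_def serR_def
    by (intro conv_radius_ge_1_arith conv_radius_lambert_pow; simp)+
qed

subsection \<open>Weights\<close>

text \<open>The index is half the usual weight. No power of R is needed since $R = EQ$.\<close>

inductive weight :: "nat \<Rightarrow> complex fps \<Rightarrow> bool" where
  monomial: "weight (i + j + 2 * k) (serP ^ i * serE ^ j * serQ ^ k)"
| diff: "weight n f \<Longrightarrow> weight n g \<Longrightarrow> weight n (f - g)"

lemma weight_zero: "weight n 0"
  using diff[OF monomial[of n 0 0] monomial[of n 0 0]] by simp

lemma weight_add: "weight n f \<Longrightarrow> weight n g \<Longrightarrow> weight n (f + g)"
  using diff[OF _ diff[OF weight_zero]] by fastforce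

lemma weight_scale: "weight n f \<Longrightarrow> weight n (of_nat c * f)"
  by (induction c) (simp_all add: weight_zero weight_add distrib_right)

lemma weight_P: "weight n f \<Longrightarrow> weight (n + 1) (serP * f)"
proof (induction rule: weight.induct)
  case (monomial i j k)
  show ?case using weight.monomial[of "Suc i" j k] by (simp add: mult_ac)
qed (simp add: right_diff_distrib weight.diff)

lemma weight_E: "weight n f \<Longrightarrow> weight (n + 1) (serE * f)"
proof (induction rule: weight.induct)
  case (monomial i j k)
  show ?case using weight.monomial[of i "Suc j" k] by (simp add: mult_ac)
qed (simp add: right_diff_distrib weight.diff)

lemma weight_Q: "weight n f \<Longrightarrow> weight (n + 2) (serQ * f)"
proof (induction rule: weight.induct)
  case (monomial i j k)
  show ?case using weight.monomial[of i j "Suc k"] by (simp add: mult_ac)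
qed (simp add: right_diff_distrib weight.diff)

lemma weight_theta: "weight n f \<Longrightarrow> weight (n + 1) (8 * theta f)"
proof (induction rule: weight.induct)
  case (monomial i j k)
  note closed = diff weight_add weight_scale[of _ _ 2, simplified] weight_scale[of _ _ 4, simplified]
    weight_scale[of _ _ 8, simplified]
  show ?case
  proof (induction i)
    case 0
    show ?case
    proof (induction j)
      case 0
      show ?case
      proof (induction k)
        case 0
        show ?case by (simp add: theta_simps weight_zero)
      next
        case (Suc k)
        let ?M = "serQ ^ k"
        have "8 * theta (serQ ^ Suc k) = 8 * (serP * (serQ * ?M) - serE * (serQ * ?M)) + serQ * (8 * theta ?M)"
          by (simp add: theta_simps theta_serQ serR_eq algebra_simps)
        moreover have "weight (2 * k + 3) (8 * (serP * (serQ * ?M) - serE * (serQ * ?M)) + serQ * (8 * theta ?M))"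
          using Suc weight.monomial[of 0 0 k] weight_P[OF weight_Q[of "2 * k" ?M]]
            weight_E[OF weight_Q[of "2 * k" ?M]] weight_Q[of "2 * k + 1" "8 * theta ?M"]
          by (intro closed) (simp_all add: eval_nat_numeral)
        ultimately show ?case by (simp add: eval_nat_numeral)
      qed
    next
      case (Suc j)
      let ?M = "serE ^ j * serQ ^ k"
      have "8 * theta (serE * ?M) = 4 * (2 * theta serE) * ?M + serE * (8 * theta ?M)"
        by (simp add: theta_simps algebra_simps)
      also have "\<dots> = 4 * (serP * (serE * ?M) - serQ * ?M) + serE * (8 * theta ?M)"
        unfolding theta_serE by (simp add: algebra_simps)
      finally have "8 * theta (serE * ?M) = \<dots>" .
      moreover have "weight (j + 2 * k + 2) (4 * (serP * (serE * ?M) - serQ * ?M) + serE * (8 * theta ?M))"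
        using Suc weight.monomial[of 0 j k] weight_P[OF weight_E[of "j + 2 * k" ?M]]
          weight_Q[of "j + 2 * k" ?M] weight_E[of "j + 2 * k + 1" "8 * theta ?M"]
        by (intro closed) (simp_all add: eval_nat_numeral)
      ultimately show ?case by (simp add: eval_nat_numeral mult_ac)
    qed
  next
    case (Suc i)
    let ?M = "serP ^ i * serE ^ j * serQ ^ k"
    have "8 * theta (serP * ?M) = 2 * (4 * theta serP) * ?M + serP * (8 * theta ?M)"
      by (simp add: theta_simps algebra_simps)
    also have "\<dots> = 2 * (serP * (serP * ?M) - serQ * ?M) + serP * (8 * theta ?M)"
      unfolding theta_serP by (simp add: algebra_simps power2_eq_square)
    finally have "8 * theta (serP * ?M) = \<dots>" .
    moreover have "weight (i + j + 2 * k + 2) (2 * (serP * (serP * ?M) - serQ * ?M) + serP * (8 * theta ?M))"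
      using Suc weight.monomial[of i j k] weight_P[OF weight_P[of "i + j + 2 * k" ?M]]
        weight_Q[of "i + j + 2 * k" ?M] weight_P[of "i + j + 2 * k + 1" "8 * theta ?M"]
      by (intro closed) (simp_all add: eval_nat_numeral)
    ultimately show ?case by (simp add: eval_nat_numeral mult_ac)
  qed
next
  case (diff n f g)
  then show ?case
    using weight.diff[of "n + 1" "8 * theta f" "8 * theta g"] by (simp add: theta_simps right_diff_distrib)
qed

lemma conv_radius_weight: "weight n f \<Longrightarrow> fps_conv_radius f \<ge> 1"
  by (induction rule: weight.induct)
    (intro conv_radius_ge_1_arith conv_radius_ge_1_power conv_radius_ser; assumption)+

lemma finite_exponents: "finite {(i, j, k, l). 2 * i + 2 * j + 4 * k + 6 * l = 2 * (n::nat)}"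
  by (rule finite_subset[of _ "{..n} \<times> {..n} \<times> {..n} \<times> {..n}"]) auto

definition isobaric_sum ::
    "nat \<Rightarrow> (nat \<Rightarrow> nat \<Rightarrow> nat \<Rightarrow> nat \<Rightarrow> int) \<Rightarrow> complex \<Rightarrow> complex" where
  "isobaric_sum n K q = (\<Sum>(i, j, k, l) \<in> {(i, j, k, l). 2 * i + 2 * j + 4 * k + 6 * l = 2 * n}.
    of_int (K i j k l) * calP q ^ i * calE q ^ j * calQ q ^ k * calR q ^ l)"

lemma isobaric_sum_diff:
  "isobaric_sum n (\<lambda>i j k l. K i j k l - M i j k l) q = isobaric_sum n K q - isobaric_sum n M q"
  unfolding isobaric_sum_def sum_subtractf [symmetric]
  by (intro sum.cong refl) (simp add: left_diff_distrib split: prod.split)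

lemma isobaric_sum_monomial:
  "isobaric_sum (i + j + 2 * k) (\<lambda>i' j' k' l. if (i', j', k', l) = (i, j, k, 0) then 1 else 0) q =
    calP q ^ i * calE q ^ j * calQ q ^ k"
proof -
  let ?I = "{(i', j', k', l). 2 * i' + 2 * j' + 4 * k' + 6 * l = 2 * (i + j + 2 * k)}"
  let ?K = "\<lambda>i' j' k' l. if (i', j', k', l) = (i, j, k, 0 :: nat) then 1 else 0 :: int"
  have "(\<Sum>(i', j', k', l) \<in> ?I.
        of_int (?K i' j' k' l) * calP q ^ i' * calE q ^ j' * calQ q ^ k' * calR q ^ l) =
      (\<Sum>t \<in> ?I. if t = (i, j, k, 0) then calP q ^ i * calE q ^ j * calQ q ^ k else 0)"
  proof (intro sum.cong refl)
    fix t :: "nat \<times> nat \<times> nat \<times> nat"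
    show "(case t of (i', j', k', l) \<Rightarrow>
          of_int (?K i' j' k' l) * calP q ^ i' * calE q ^ j' * calQ q ^ k' * calR q ^ l) =
        (if t = (i, j, k, 0) then calP q ^ i * calE q ^ j * calQ q ^ k else 0)"
      by (cases t) (cases "t = (i, j, k, 0)"; auto)
  qed
  also have "\<dots> = calP q ^ i * calE q ^ j * calQ q ^ k"
    using finite_exponents[of "i + j + 2 * k"] by simp
  finally show ?thesis
    unfolding isobaric_sum_def .
qed

lemma weight_expansion:
  assumes "weight n f"
  shows "\<exists>K. \<forall>q. norm q < 1 \<longrightarrow> eval_fps f q = isobaric_sum n K q"
  using assms
proof (induction rule: weight.induct)
  case (monomial i j k)
  have "eval_fps (serP ^ i * serE ^ j * serQ ^ k) q =
      isobaric_sum (i + j + 2 * k) (\<lambda>i' j' k' l. if (i', j', k', l) = (i, j, k, 0) then 1 else 0) q"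
    if "norm q < 1" for q
    unfolding isobaric_sum_monomial cal_eq_eval
    by (simp add: eval_fps_mult eval_fps_power less_fps_conv_radius conv_radius_ge_1_arith
        conv_radius_ge_1_power conv_radius_ser that)
  then show ?case by blast
next
  case (diff n f g)
  then obtain K M where
    KM: "\<And>q. norm q < 1 \<Longrightarrow> eval_fps f q = isobaric_sum n K q"
      "\<And>q. norm q < 1 \<Longrightarrow> eval_fps g q = isobaric_sum n M q"
    by metis
  have "eval_fps (f - g) q = isobaric_sum n (\<lambda>i j k l. K i j k l - M i j k l) q"
    if "norm q < 1" for q
    unfolding isobaric_sum_diff KM[OF that, symmetric]
    using diff.hyps that by (intro eval_fps_diff less_fps_conv_radius) (auto intro: conv_radius_weight)
  then show ?case by blast
qed

lemma ser_psi_quotient_step: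
  assumes "ser_psi n = f * ser_psi 0"
  shows "ser_psi (n + 2) = (serP * f + 8 * theta f) * ser_psi 0"
  unfolding ser_psi_step assms theta_simps(3) theta_ser_psi_0 serP_def by (simp add: algebra_simps)

lemma ser_psi_even: "\<exists>f. weight n f \<and> ser_psi (2 * n) = f * ser_psi 0"
proof (induction n)
  case 0
  show ?case using weight.monomial[of 0 0 0] by (intro exI[of _ 1]) simp
next
  case (Suc n)
  then obtain f where f: "weight n f" "ser_psi (2 * n) = f * ser_psi 0" by blast
  have "weight (Suc n) (serP * f + 8 * theta f)"
    using weight_add[OF weight_P[OF f(1)] weight_theta[OF f(1)]] by simp
  moreover have "ser_psi (2 * Suc n) = (serP * f + 8 * theta f) * ser_psi 0"
    using ser_psi_quotient_step[OF f(2)] by simp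
  ultimately show ?case by blast
qed

lemma psi_quotient:
  assumes "ser_psi n = f * ser_psi 0" "fps_conv_radius f \<ge> 1" "norm q < 1"
  shows "psi n q / psi 0 q = eval_fps f q"
proof -
  have "psi n q = eval_fps f q * psi 0 q"
    unfolding psi_eq_eval[OF assms(3)] assms(1)
    by (intro eval_fps_mult less_fps_conv_radius assms conv_radius_ser_psi)
  then show ?thesis
    using psi_0_nonzero[OF assms(3)] by simp
qed

lemma ser_psi_2_4_6:
  "ser_psi 2 = serP * ser_psi 0"
  "ser_psi 4 = (3 * serP ^ 2 - 2 * serQ) * ser_psi 0"
  "ser_psi 6 = (15 * serP ^ 3 - 30 * serP * serQ + 16 * serR) * ser_psi 0"
proof -
  show 2: "ser_psi 2 = serP * ser_psi 0"
    using ser_psi_quotient_step[of 0 1] by (simp add: theta_simps numeral_2_eq_2)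
  have "serP * serP + 8 * theta serP = serP * serP + 2 * (4 * theta serP)"
    by simp
  also have "\<dots> = 3 * serP ^ 2 - 2 * serQ"
    unfolding theta_serP by (simp add: algebra_simps power2_eq_square)
  finally show 4: "ser_psi 4 = (3 * serP ^ 2 - 2 * serQ) * ser_psi 0"
    using ser_psi_quotient_step[OF 2] by simp
  have "serP * (3 * serP ^ 2 - 2 * serQ) + 8 * theta (3 * serP ^ 2 - 2 * serQ)
      = serP * (3 * serP ^ 2 - 2 * serQ) + 12 * serP * (4 * theta serP) - 16 * theta serQ"
    by (simp add: theta_simps power2_eq_square algebra_simps)
  also have "\<dots> = 15 * serP ^ 3 - 30 * serP * serQ + 16 * serR"
    unfolding theta_serP theta_serQ by (simp add: algebra_simps power2_eq_square power3_eq_cube)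
  finally show "ser_psi 6 = (15 * serP ^ 3 - 30 * serP * serQ + 16 * serR) * ser_psi 0"
    using ser_psi_quotient_step[OF 4] by simp
qed

theorem theorem2p10:
  shows "(\<forall>q :: complex. norm q < 1 \<longrightarrow>
            psi 2 q / psi 0 q = calP q \<and>
            psi 4 q / psi 0 q = 3 * calP q ^ 2 - 2 * calQ q \<and>
            psi 6 q / psi 0 q = 15 * calP q ^ 3 - 30 * calP q * calQ q + 16 * calR q) \<and>
         (\<forall>n :: nat. \<exists>K :: nat \<Rightarrow> nat \<Rightarrow> nat \<Rightarrow> nat \<Rightarrow> int. \<forall>q :: complex. norm q < 1 \<longrightarrow>
            psi (2 * n) q / psi 0 q =
              (\<Sum>(i, j, k, l) \<in> {(i, j, k, l). 2 * i + 2 * j + 4 * k + 6 * l = 2 * n}.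
                 of_int (K i j k l) * calP q ^ i * calE q ^ j * calQ q ^ k * calR q ^ l))"
proof (intro conjI allI impI)
  fix q :: complex
  assume q: "norm q < 1"
  note radius = conv_radius_ge_1_arith conv_radius_ge_1_power conv_radius_ser
  note eval = eval_fps_add eval_fps_diff eval_fps_mult eval_fps_power
  show "psi 2 q / psi 0 q = calP q"
    unfolding cal_eq_eval by (rule psi_quotient[OF ser_psi_2_4_6(1) _ q]) (rule radius)
  show "psi 4 q / psi 0 q = 3 * calP q ^ 2 - 2 * calQ q"
    unfolding cal_eq_eval
    by (subst psi_quotient[OF ser_psi_2_4_6(2) _ q]) (simp_all add: radius eval less_fps_conv_radius q)
  show "psi 6 q / psi 0 q = 15 * calP q ^ 3 - 30 * calP q * calQ q + 16 * calR q"
    unfolding cal_eq_eval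
    by (subst psi_quotient[OF ser_psi_2_4_6(3) _ q]) (simp_all add: radius eval less_fps_conv_radius q)
next
  fix n
  obtain f where f: "weight n f" "ser_psi (2 * n) = f * ser_psi 0"
    using ser_psi_even by blast
  show "\<exists>K :: nat \<Rightarrow> nat \<Rightarrow> nat \<Rightarrow> nat \<Rightarrow> int. \<forall>q. norm q < 1 \<longrightarrow>
            psi (2 * n) q / psi 0 q =
              (\<Sum>(i, j, k, l) \<in> {(i, j, k, l). 2 * i + 2 * j + 4 * k + 6 * l = 2 * n}.
                 of_int (K i j k l) * calP q ^ i * calE q ^ j * calQ q ^ k * calR q ^ l)"
    using weight_expansion[OF f(1)] psi_quotient[OF f(2) conv_radius_weight[OF f(1)]]
    unfolding isobaric_sum_def by simp
qed

end
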